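(* (1) A generic positive continuous function on $\mathbb{R}^2$ cannot be written as the Jacobian of a bi-Lipschitz homeomorphism: the set of all $\rho\in C_+(\mathbb{R}^2,\mathbb{R})$ for which there is no bi-Lipschitz homeomorphism $f:\mathbb{R}^2\to\mathbb{R}^2$ with $Jac(f)=\rho$ almost everywhere is a thick subset of $C_+(\mathbb{R}^2,\mathbb{R})$. (2) The same holds for a generic positive $L^\infty$ function: the set of all $\rho\in L^\infty_+(\mathbb{R}^2,\mathbb{R})$ for which there is no bi-Lipschitz homeomorphism $f:\mathbb{R}^2\to\mathbb{R}^2$ with $Jac(f)=\rho$ almost everywhere is a thick subset of $L^\infty_+(\mathbb{R}^2,\mathbb{R})$.
   Context: A map $f:(X_1,d_1)\to(X_2,d_2)$ between metric spaces is $L$-bi-Lipschitz if $\frac1L d_1(x,y)\le d_2(f(x),f(y))\le L\,d_1(x,y)$ for all $x,y\in X_1$, and bi-Lipschitz if it is $L$-bi-Lipschitz for some $L\ge 1$. The plane carries the Euclidean metric and Lebesgue measure. For a Lipschitz map $f$ of planar domains, $Jac(f)=\det Df$, which is defined almost everywhere by Rademacher's theorem. A subset $G$ of a metric space $M$ is thick if it contains a set of the form $\bigcap_{n\in\mathbb{N}}G_n$ with each $G_n$ open and dense in $M$; a property is generic in $M$ if it is satisfied by all points of some thick subset of $M$. $C_+(\mathbb{R}^2,\mathbb{R})$ is the set of continuous functions $\rho:\mathbb{R}^2\to\mathbb{R}$ that are everywhere positive, with the metric of uniform convergence $d(\rho,\rho')=\min\{1,\sup_{x\in\mathbb{R}^2}|\rho(x)-\rho'(x)|\}$.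 $L^\infty_+(\mathbb{R}^2,\mathbb{R})$ is the set of (classes of) functions $\rho\in L^\infty(\mathbb{R}^2,\mathbb{R})$ with $\rho(x)>0$ for almost every $x$, with the metric induced by $\|\cdot\|_\infty$. *)

theory Defs
  imports "HOL-Analysis.Analysis" "HOL-Probability.Essential_Supremum"
begin

section \<open>Bi-Lipschitz homeomorphisms and Jacobians\<close>

definition bi_lipschitz_const :: "real \<Rightarrow> ('a::metric_space \<Rightarrow> 'b::metric_space) \<Rightarrow> bool" where
  "bi_lipschitz_const L f \<longleftrightarrow>
     (\<forall>x y. (1 / L) * dist x y \<le> dist (f x) (f y) \<and> dist (f x) (f y) \<le> L * dist x y)"

definition bi_lipschitz :: "('a::metric_space \<Rightarrow> 'b::metric_space) \<Rightarrow> bool" where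
  "bi_lipschitz f \<longleftrightarrow> (\<exists>L\<ge>1. bi_lipschitz_const L f)"

definition bi_lipschitz_homeo :: "('a::metric_space \<Rightarrow> 'b::metric_space) \<Rightarrow> bool" where
  "bi_lipschitz_homeo f \<longleftrightarrow> bi_lipschitz f \<and> (\<exists>g. homeomorphism UNIV UNIV f g)"

text \<open>Only meaningful at points where \<open>f\<close> is differentiable.\<close>

definition Jac :: "(real^2 \<Rightarrow> real^2) \<Rightarrow> real^2 \<Rightarrow> real" where
  "Jac f x = det (matrix (frechet_derivative f (at x)))"

text \<open>The differentiability conjunct records that \<open>Jac f\<close> is defined almost everywhere; for the
  Lipschitz maps considered here it is automatic by Rademacher's theorem.\<close>

definition Jac_eq_AE :: "(real^2 \<Rightarrow> real^2) \<Rightarrow> (real^2 \<Rightarrow> real) \<Rightarrow> bool" where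
  "Jac_eq_AE f \<rho> \<longleftrightarrow> (AE x in lebesgue. f differentiable (at x) \<and> Jac f x = \<rho> x)"


section \<open>Thick sets\<close>

definition thick :: "'a metric \<Rightarrow> 'a set \<Rightarrow> bool" where
  "thick m G \<longleftrightarrow> G \<subseteq> mspace m \<and>
     (\<exists>U :: nat \<Rightarrow> 'a set.
        (\<forall>n. openin (mtopology_of m) (U n) \<and> mtopology_of m closure_of U n = mspace m) \<and>
        (\<Inter>n. U n) \<subseteq> G)"


section \<open>Positive continuous functions with the metric of uniform convergence\<close>

definition Cplus :: "(real^2 \<Rightarrow> real) set" where
  "Cplus = {\<rho>. continuous_on UNIV \<rho> \<and> (\<forall>x. \<rho> x > 0)}"

text \<open>The supremum is taken in the extended reals, since it may be infinite.\<close>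

definition Cplus_dist :: "(real^2 \<Rightarrow> real) \<Rightarrow> (real^2 \<Rightarrow> real) \<Rightarrow> real" where
  "Cplus_dist \<rho> \<sigma> = real_of_ereal (min 1 (SUP x. ereal \<bar>\<rho> x - \<sigma> x\<bar>))"

definition Cplus_metric :: "(real^2 \<Rightarrow> real) metric" where
  "Cplus_metric = metric (Cplus, Cplus_dist)"

lemma ereal_Cplus_dist: "ereal (Cplus_dist \<rho> \<sigma>) = min 1 (SUP x. ereal \<bar>\<rho> x - \<sigma> x\<bar>)"
proof -
  have "0 \<le> (SUP x. ereal \<bar>\<rho> x - \<sigma> x\<bar>)"
    by (rule SUP_upper2[of undefined]) auto
  then have "0 \<le> min 1 (SUP x. ereal \<bar>\<rho> x - \<sigma> x\<bar>)" "min 1 (SUP x. ereal \<bar>\<rho> x - \<sigma> x\<bar>) \<le> 1"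
    by auto
  then show ?thesis
    unfolding Cplus_dist_def
    by (intro ereal_real') (metis abs_ereal_ge0 ereal_infty_less_eq(1) infinity_ereal_def one_ereal_def ereal_less_eq(1) PInfty_neq_ereal(1))
qed

lemma Metric_space_Cplus: "Metric_space Cplus Cplus_dist"
proof
  fix \<rho> \<sigma> :: "real^2 \<Rightarrow> real"
  have nn: "0 \<le> (SUP x. ereal \<bar>\<rho> x - \<sigma> x\<bar>)" for \<rho> \<sigma> :: "real^2 \<Rightarrow> real"
    by (rule SUP_upper2[of undefined]) auto
  have "0 \<le> ereal (Cplus_dist \<rho> \<sigma>)"
    unfolding ereal_Cplus_dist using nn by auto
  then show "0 \<le> Cplus_dist \<rho> \<sigma>" by simp
  show "Cplus_dist \<rho> \<sigma> = Cplus_dist \<sigma> \<rho>"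
    by (simp add: Cplus_dist_def abs_minus_commute)
  show "Cplus_dist \<rho> \<sigma> = 0 \<longleftrightarrow> \<rho> = \<sigma>"
  proof
    assume "Cplus_dist \<rho> \<sigma> = 0"
    then have "min 1 (SUP x. ereal \<bar>\<rho> x - \<sigma> x\<bar>) = 0"
      by (metis ereal_Cplus_dist zero_ereal_def)
    then have "(SUP x. ereal \<bar>\<rho> x - \<sigma> x\<bar>) = 0"
      by (auto simp: min_def split: if_splits)
    then have "ereal \<bar>\<rho> x - \<sigma> x\<bar> \<le> 0" for x
      by (metis SUP_upper UNIV_I)
    then show "\<rho> = \<sigma>" by (auto intro!: ext)
  qed (simp add: Cplus_dist_def)
  fix \<tau> :: "real^2 \<Rightarrow> real"
  have "(SUP x. ereal \<bar>\<rho> x - \<tau> x\<bar>)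
      \<le> (SUP x. ereal \<bar>\<rho> x - \<sigma> x\<bar>) + (SUP x. ereal \<bar>\<sigma> x - \<tau> x\<bar>)" (is "?a \<le> ?b + ?c")
  proof (rule SUP_least)
    fix x
    have "ereal \<bar>\<rho> x - \<tau> x\<bar> \<le> ereal \<bar>\<rho> x - \<sigma> x\<bar> + ereal \<bar>\<sigma> x - \<tau> x\<bar>" by simp
    also have "\<dots> \<le> ?b + ?c" by (intro add_mono SUP_upper) auto
    finally show "ereal \<bar>\<rho> x - \<tau> x\<bar> \<le> ?b + ?c" .
  qed
  then have "min 1 ?a \<le> min 1 ?b + min 1 ?c"
    using nn[of \<rho> \<sigma>] nn[of \<sigma> \<tau>] nn[of \<rho> \<tau>]
    by (cases ?a; cases ?b; cases ?c) (auto simp: min_def one_ereal_def)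
  then have "ereal (Cplus_dist \<rho> \<tau>) \<le> ereal (Cplus_dist \<rho> \<sigma>) + ereal (Cplus_dist \<sigma> \<tau>)"
    by (simp only: ereal_Cplus_dist)
  then show "Cplus_dist \<rho> \<tau> \<le> Cplus_dist \<rho> \<sigma> + Cplus_dist \<sigma> \<tau>" by simp
qed

lemma mspace_Cplus_metric [simp]: "mspace Cplus_metric = Cplus"
  and mdist_Cplus_metric [simp]: "mdist Cplus_metric = Cplus_dist"
  by (simp_all add: Cplus_metric_def Metric_space.mspace_metric Metric_space.mdist_metric
      Metric_space_Cplus)


section \<open>Positive essentially bounded functions with the essential supremum metric\<close>

definition Linf_norm :: "(real^2 \<Rightarrow> real) \<Rightarrow> real" where
  "Linf_norm \<rho> = real_of_ereal (esssup lebesgue (\<lambda>x. ereal \<bar>\<rho> x\<bar>))"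

definition Linf_funs :: "(real^2 \<Rightarrow> real) set" where
  "Linf_funs = {\<rho> \<in> borel_measurable lebesgue. esssup lebesgue (\<lambda>x. ereal \<bar>\<rho> x\<bar>) < \<infinity>}"

definition Linf_rel :: "((real^2 \<Rightarrow> real) \<times> (real^2 \<Rightarrow> real)) set" where
  "Linf_rel = {(\<rho>, \<sigma>). \<rho> \<in> Linf_funs \<and> \<sigma> \<in> Linf_funs \<and> (AE x in lebesgue. \<rho> x = \<sigma> x)}"

definition Linf_plus :: "(real^2 \<Rightarrow> real) set set" where
  "Linf_plus = {R \<in> Linf_funs // Linf_rel. \<forall>\<rho>\<in>R. AE x in lebesgue. \<rho> x > 0}"

text \<open>The choice of representatives does not matter, see \<open>Linf_dist_eq\<close> below.\<close>

definition Linf_dist :: "(real^2 \<Rightarrow> real) set \<Rightarrow> (real^2 \<Rightarrow> real) set \<Rightarrow> real" where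
  "Linf_dist R S = Linf_norm (\<lambda>x. (SOME \<rho>. \<rho> \<in> R) x - (SOME \<sigma>. \<sigma> \<in> S) x)"

definition Linf_plus_metric :: "(real^2 \<Rightarrow> real) set metric" where
  "Linf_plus_metric = metric (Linf_plus, Linf_dist)"

lemma equiv_Linf_rel: "equiv Linf_funs Linf_rel"
  by (rule equivI) (auto simp: Linf_rel_def refl_on_def sym_def trans_def)

lemma Linf_class_nonempty: "R \<in> Linf_funs // Linf_rel \<Longrightarrow> (SOME \<rho>. \<rho> \<in> R) \<in> R"
  using in_quotient_imp_non_empty[OF equiv_Linf_rel] by (metis ex_in_conv someI_ex)

lemma Linf_class_subset: "R \<in> Linf_funs // Linf_rel \<Longrightarrow> \<rho> \<in> R \<Longrightarrow> \<rho> \<in> Linf_funs"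
  using in_quotient_imp_subset[OF equiv_Linf_rel] by blast

lemma Linf_class_AE_eq:
  assumes "R \<in> Linf_funs // Linf_rel" "\<rho> \<in> R" "\<sigma> \<in> R"
  shows "AE x in lebesgue. \<rho> x = \<sigma> x"
  using in_quotient_imp_in_rel[OF equiv_Linf_rel assms(1), of \<rho> \<sigma>] assms
  by (auto simp: Linf_rel_def)

lemma esssup_abs_nonneg: "0 \<le> esssup lebesgue (\<lambda>x::real^2. ereal \<bar>\<rho> x\<bar>)"
proof (cases "(\<lambda>x. ereal \<bar>\<rho> x\<bar>) \<in> borel_measurable lebesgue")
  case True
  have "esssup lebesgue (\<lambda>x::real^2. 0::ereal) \<le> esssup lebesgue (\<lambda>x. ereal \<bar>\<rho> x\<bar>)"
    by (rule esssup_mono) auto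
  then show ?thesis by (simp add: esssup_const)
qed (simp add: esssup_non_measurable top_ereal_def)

lemma Linf_norm_nonneg: "0 \<le> Linf_norm \<rho>"
  unfolding Linf_norm_def by (intro real_of_ereal_pos esssup_abs_nonneg)

lemma Linf_norm_cong:
  assumes [measurable]: "\<rho> \<in> borel_measurable lebesgue" "\<sigma> \<in> borel_measurable lebesgue"
    and "AE x in lebesgue. \<rho> x = \<sigma> x"
  shows "Linf_norm \<rho> = Linf_norm \<sigma>"
proof -
  have "AE x in lebesgue. ereal \<bar>\<rho> x\<bar> = ereal \<bar>\<sigma> x\<bar>"
    using assms(3) by eventually_elim simp
  then show ?thesis
    unfolding Linf_norm_def by (subst esssup_AE_cong) auto
qed

lemma Linf_dist_eq:
  assumes "R \<in> Linf_funs // Linf_rel" "S \<in> Linf_funs // Linf_rel" "\<rho> \<in> R" "\<sigma> \<in> S"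
  shows "Linf_dist R S = Linf_norm (\<lambda>x. \<rho> x - \<sigma> x)"
proof -
  let ?r = "SOME \<rho>. \<rho> \<in> R" and ?s = "SOME \<sigma>. \<sigma> \<in> S"
  note mem = Linf_class_nonempty[OF assms(1)] Linf_class_nonempty[OF assms(2)]
  have [measurable]: "\<rho> \<in> borel_measurable lebesgue" "\<sigma> \<in> borel_measurable lebesgue"
    "?r \<in> borel_measurable lebesgue" "?s \<in> borel_measurable lebesgue"
    using assms mem Linf_class_subset unfolding Linf_funs_def by blast+
  have "AE x in lebesgue. ?r x - ?s x = \<rho> x - \<sigma> x"
    using Linf_class_AE_eq[OF assms(1) mem(1) assms(3)] Linf_class_AE_eq[OF assms(2) mem(2) assms(4)]
    by eventually_elim simp
  then show ?thesis
    unfolding Linf_dist_def by (intro Linf_norm_cong) auto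
qed

lemma Linf_norm_AE_le:
  assumes "\<rho> \<in> Linf_funs" shows "AE x in lebesgue. \<bar>\<rho> x\<bar> \<le> Linf_norm \<rho>"
proof -
  have "\<bar>esssup lebesgue (\<lambda>x. ereal \<bar>\<rho> x\<bar>)\<bar> \<noteq> \<infinity>"
    using assms esssup_abs_nonneg[of \<rho>] unfolding Linf_funs_def by auto
  then have e: "esssup lebesgue (\<lambda>x. ereal \<bar>\<rho> x\<bar>) = ereal (Linf_norm \<rho>)"
    unfolding Linf_norm_def by (simp add: ereal_real')
  show ?thesis
    using esssup_AE[of "\<lambda>x. ereal \<bar>\<rho> x\<bar>" lebesgue] unfolding e by simp
qed

lemma Linf_bounded:
  assumes [measurable]: "\<rho> \<in> borel_measurable lebesgue" and "AE x in lebesgue. \<bar>\<rho> x\<bar> \<le> C"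
  shows "\<rho> \<in> Linf_funs" "Linf_norm \<rho> \<le> C"
proof -
  have le: "esssup lebesgue (\<lambda>x. ereal \<bar>\<rho> x\<bar>) \<le> ereal C"
    using assms by (intro esssup_I) auto
  then show "\<rho> \<in> Linf_funs" by (auto simp: Linf_funs_def)
  show "Linf_norm \<rho> \<le> C"
    unfolding Linf_norm_def using le esssup_abs_nonneg[of \<rho>]
    by (cases "esssup lebesgue (\<lambda>x. ereal \<bar>\<rho> x\<bar>)") auto
qed

lemma Linf_funs_diff:
  assumes "\<rho> \<in> Linf_funs" "\<sigma> \<in> Linf_funs"
  shows "(\<lambda>x. \<rho> x - \<sigma> x) \<in> Linf_funs"
proof (rule Linf_bounded)
  show "(\<lambda>x. \<rho> x - \<sigma> x) \<in> borel_measurable lebesgue"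
    using assms by (auto simp: Linf_funs_def)
  show "AE x in lebesgue. \<bar>\<rho> x - \<sigma> x\<bar> \<le> Linf_norm \<rho> + Linf_norm \<sigma>"
    using Linf_norm_AE_le[OF assms(1)] Linf_norm_AE_le[OF assms(2)] by eventually_elim linarith
qed

lemma Metric_space_Linf_plus: "Metric_space Linf_plus Linf_dist"
proof
  fix R S
  show "0 \<le> Linf_dist R S" by (simp add: Linf_dist_def Linf_norm_nonneg)
  show "Linf_dist R S = Linf_dist S R"
    by (simp add: Linf_dist_def Linf_norm_def abs_minus_commute)
  assume "R \<in> Linf_plus" "S \<in> Linf_plus"
  then have R: "R \<in> Linf_funs // Linf_rel" and S: "S \<in> Linf_funs // Linf_rel"
    by (auto simp: Linf_plus_def)
  obtain \<rho> \<sigma> where \<rho>: "\<rho> \<in> R" and \<sigma>: "\<sigma> \<in> S"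
    using Linf_class_nonempty R S by blast
  have f: "\<rho> \<in> Linf_funs" "\<sigma> \<in> Linf_funs"
    using R S \<rho> \<sigma> Linf_class_subset by blast+
  have d: "Linf_dist R S = Linf_norm (\<lambda>x. \<rho> x - \<sigma> x)"
    by (rule Linf_dist_eq[OF R S \<rho> \<sigma>])
  show "Linf_dist R S = 0 \<longleftrightarrow> R = S"
  proof
    assume "Linf_dist R S = 0"
    then have "AE x in lebesgue. \<rho> x = \<sigma> x"
      using Linf_norm_AE_le[OF Linf_funs_diff[OF f]] d by simp
    then have "(\<rho>, \<sigma>) \<in> Linf_rel" using f by (simp add: Linf_rel_def)
    then show "R = S" using quotient_eq_iff[OF equiv_Linf_rel R S \<rho> \<sigma>] by simp
  next
    assume "R = S"
    then have "Linf_dist R S = Linf_norm (\<lambda>x. 0)" by (simp add: Linf_dist_def)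
    moreover have "Linf_norm (\<lambda>x. 0) \<le> 0" by (rule Linf_bounded) auto
    ultimately show "Linf_dist R S = 0" using Linf_norm_nonneg[of "\<lambda>x. 0"] by simp
  qed
  fix T assume "T \<in> Linf_plus"
  then have T: "T \<in> Linf_funs // Linf_rel" by (auto simp: Linf_plus_def)
  obtain \<tau> where \<tau>: "\<tau> \<in> T" using Linf_class_nonempty T by blast
  have g: "\<tau> \<in> Linf_funs" using T \<tau> Linf_class_subset by blast
  have "Linf_norm (\<lambda>x. \<rho> x - \<tau> x) \<le> Linf_norm (\<lambda>x. \<rho> x - \<sigma> x) + Linf_norm (\<lambda>x. \<sigma> x - \<tau> x)"
  proof (rule Linf_bounded)
    show "(\<lambda>x. \<rho> x - \<tau> x) \<in> borel_measurable lebesgue"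
      using f g by (auto simp: Linf_funs_def)
    show "AE x in lebesgue. \<bar>\<rho> x - \<tau> x\<bar> \<le> Linf_norm (\<lambda>x. \<rho> x - \<sigma> x) + Linf_norm (\<lambda>x. \<sigma> x - \<tau> x)"
      using Linf_norm_AE_le[OF Linf_funs_diff[OF f]] Linf_norm_AE_le[OF Linf_funs_diff[OF f(2) g]]
      by eventually_elim linarith
  qed
  then show "Linf_dist R T \<le> Linf_dist R S + Linf_dist S T"
    by (simp add: Linf_dist_eq[OF R S \<rho> \<sigma>] Linf_dist_eq[OF S T \<sigma> \<tau>] Linf_dist_eq[OF R T \<rho> \<tau>])
qed

lemma mspace_Linf_plus_metric [simp]: "mspace Linf_plus_metric = Linf_plus"
  and mdist_Linf_plus_metric [simp]: "mdist Linf_plus_metric = Linf_dist"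
  by (simp_all add: Linf_plus_metric_def Metric_space.mspace_metric Metric_space.mdist_metric
      Metric_space_Linf_plus)

end

theory Submission
  imports Defs "HOL-Complex_Analysis.Great_Picard" "HOL-Real_Asymp.Real_Asymp"
begin

text \<open>
  For a bi-Lipschitz homeomorphism \<open>f\<close> with inverse \<open>g\<close>, the equation \<open>Jac f = s\<close> implies that \<open>f\<close>
  carries the measure with density \<open>s\<close> to Lebesgue measure. This weak form survives pointwise limits
  of maps with uniform bi-Lipschitz constants, so it suffices to show that for fixed constants the
  realizable densities have empty interior. A ball of realizable densities would, after blowing up at
  a point (of density, in the essentially bounded case), make every measurable \<open>s\<close> with values in
  some interval \<open>[a, b]\<close> realizable with the same constants.

  To exclude this, let \<open>\<Lambda>\<close> be the infimum of the Lipschitz constants of \<open>f\<close> that suffice for all such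
  \<open>s\<close>, with that of \<open>g\<close> fixed. Some \<open>s\<close> is not realizable with a constant slightly below \<open>\<Lambda>\<close>. By
  compactness, every small perturbation of it forces an almost maximal stretch of one of finitely many
  segments, hence of one piece of a fine subdivision of that segment. As the plane has dimension at
  least two, one can perturb \<open>s\<close> cheaply so that around the midpoint of every piece it is \<open>a\<close> on one side
  and \<open>b\<close> on the other side of the orthogonal line. Blowing up at the stretched piece gives a
  \<open>\<Lambda>\<close>-Lipschitz map that stretches a whole line by exactly \<open>\<Lambda>\<close> and realizes the half-plane
  density with values \<open>a\<close> and \<open>b\<close>. Such a map commutes with translations along the line, so its
  density is invariant under them, and \<open>a = b\<close>.
\<close>

section \<open>Transport of densities by bi-Lipschitz pairs\<close>

text \<open>The constants of the map and of its inverse are kept apart, so that the first can be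
  minimised while the second stays fixed.\<close>

definition lip_pair :: "real \<Rightarrow> real \<Rightarrow> ('a::metric_space \<Rightarrow> 'a) \<Rightarrow> ('a \<Rightarrow> 'a) \<Rightarrow> bool" where
  "lip_pair K L f g \<longleftrightarrow> K-lipschitz_on UNIV f \<and> L-lipschitz_on UNIV g \<and>
     (\<forall>x. g (f x) = x) \<and> (\<forall>y. f (g y) = y)"

definition test_fun :: "('a::euclidean_space \<Rightarrow> real) \<Rightarrow> bool" where
  "test_fun \<phi> \<longleftrightarrow> continuous_on UNIV \<phi> \<and> (\<exists>R. \<forall>x. R < norm x \<longrightarrow> \<phi> x = 0)"

text \<open>For an inverse pair \<open>f\<close>, \<open>g\<close> this says that the image under \<open>f\<close> of the measure with
  density \<open>s\<close> is Lebesgue measure, which is the weak form of \<open>Jac f = s\<close>.\<close>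

definition realizes :: "('a::euclidean_space \<Rightarrow> 'a) \<Rightarrow> ('a \<Rightarrow> real) \<Rightarrow> bool" where
  "realizes g s \<longleftrightarrow> (\<forall>\<phi>. test_fun \<phi> \<longrightarrow>
     (\<integral>y. \<phi> (g y) \<partial>lborel) = (\<integral>x. \<phi> x * s x \<partial>lborel))"

lemma lip_pair_D:
  assumes "lip_pair K L f g"
  shows "dist (f x) (f y) \<le> K * dist x y" "dist (g x) (g y) \<le> L * dist x y"
    "g (f x) = x" "f (g y) = y" "0 \<le> K" "0 \<le> L" "continuous_on UNIV f" "continuous_on UNIV g"
  using assms unfolding lip_pair_def
  by (auto dest: lipschitz_onD lipschitz_on_nonneg intro: lipschitz_on_continuous_on)

lemma lip_pairI:
  assumes "\<And>x y. dist (f x) (f y) \<le> K * dist x y" "\<And>x y. dist (g x) (g y) \<le> L * dist x y"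
    "\<And>x. g (f x) = x" "\<And>y. f (g y) = y" "0 \<le> K" "0 \<le> L"
  shows "lip_pair K L f g"
  using assms unfolding lip_pair_def by (auto intro!: lipschitz_onI)

lemma lip_pair_mono:
  assumes "lip_pair K L f g" "K \<le> K'" "L \<le> L'"
  shows "lip_pair K' L' f g"
  using assms unfolding lip_pair_def by (auto intro: lipschitz_on_le)

lemma test_fun_bounded:
  fixes \<phi> :: "'a::euclidean_space \<Rightarrow> real"
  assumes "test_fun \<phi>"
  obtains B R where "0 < B" "0 < R" "\<And>x. \<bar>\<phi> x\<bar> \<le> B" "\<And>x. R < norm x \<Longrightarrow> \<phi> x = 0"
proof -
  obtain R0 where R0: "\<And>x. R0 < norm x \<Longrightarrow> \<phi> x = 0" and c: "continuous_on UNIV \<phi>"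
    using assms by (auto simp: test_fun_def)
  define R where "R = max R0 1"
  have "compact (\<phi> ` cball 0 R)"
    by (intro compact_continuous_image continuous_on_subset[OF c]) auto
  then have "bounded (\<phi> ` cball 0 R)" by (rule compact_imp_bounded)
  then obtain B where B: "0 < B" "\<And>x. x \<in> cball 0 R \<Longrightarrow> \<bar>\<phi> x\<bar> \<le> B"
    by (auto simp: bounded_pos)
  show ?thesis
  proof
    show "0 < B" by fact
    show "0 < R" by (simp add: R_def)
    show "\<phi> x = 0" if "R < norm x" for x using R0[of x] that by (auto simp: R_def)
    then show "\<bar>\<phi> x\<bar> \<le> B" for x using B(2)[of x] B(1) by (cases "norm x \<le> R") auto
  qed
qed

lemma test_fun_borel [measurable_dest]: "test_fun \<phi> \<Longrightarrow> \<phi> \<in> borel_measurable borel"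
  by (simp add: test_fun_def borel_measurable_continuous_onI)

lemma integrable_indicat_cball: "integrable lborel (\<lambda>x::'a::euclidean_space. B * indicat_real (cball c R) x)"
  by (intro integrable_mult_right integrable_real_indicator emeasure_bounded_finite[OF bounded_cball]) simp

lemma integrable_bounded_support:
  fixes f :: "'a::euclidean_space \<Rightarrow> real"
  assumes [measurable]: "f \<in> borel_measurable borel"
    and "AE x in lborel. \<bar>f x\<bar> \<le> B" "\<And>x. R < norm x \<Longrightarrow> f x = 0"
  shows "integrable lborel f"
proof (rule Bochner_Integration.integrable_bound[OF integrable_indicat_cball[of B 0 R]])
  show "AE x in lborel. norm (f x) \<le> norm (B * indicat_real (cball 0 R) x)"
    using assms(2)
  proof eventually_elim
    case (elim x)
    then show ?case using assms(3)[of x] by (auto simp: indicator_def not_le)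
  qed
qed simp

subsection \<open>Change of scale\<close>

lemma lborel_integral_affine:
  fixes f :: "'a::euclidean_space \<Rightarrow> real"
  assumes [measurable]: "f \<in> borel_measurable borel" and c: "0 < c"
  shows "(\<integral>x. f x \<partial>lborel) = c ^ DIM('a) * (\<integral>x. f (t + c *\<^sub>R x) \<partial>lborel)"
proof -
  have "(\<integral>x. f x \<partial>lborel)
      = (\<integral>x. f x \<partial>density (distr lborel borel (\<lambda>x. t + c *\<^sub>R x)) (\<lambda>_. ennreal (\<bar>c\<bar>^DIM('a))))"
    using lborel_affine[of c t] c by (simp add: ennreal_power)
  also have "\<dots> = (\<integral>x. c ^ DIM('a) *\<^sub>R f x \<partial>distr lborel borel (\<lambda>x. t + c *\<^sub>R x))"
    using c by (subst integral_density) auto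
  also have "\<dots> = c ^ DIM('a) * (\<integral>x. f (t + c *\<^sub>R x) \<partial>lborel)"
    by (subst integral_distr) auto
  finally show ?thesis .
qed

lemma lborel_emeasure_affine:
  fixes A :: "'a::euclidean_space set"
  assumes [measurable]: "A \<in> sets borel" and c: "0 < c"
  shows "emeasure lborel A = ennreal (c ^ DIM('a)) * emeasure lborel {x. t + c *\<^sub>R x \<in> A}"
proof -
  have "emeasure lborel A
      = emeasure (density (distr lborel borel (\<lambda>x. t + c *\<^sub>R x)) (\<lambda>_. ennreal (\<bar>c\<bar>^DIM('a)))) A"
    using lborel_affine[of c t] c by (simp add: ennreal_power)
  also have "\<dots> = ennreal (c ^ DIM('a)) * emeasure (distr lborel borel (\<lambda>x. t + c *\<^sub>R x)) A"
    using c by (subst emeasure_density) (auto simp: nn_integral_cmult_indicator)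
  also have "emeasure (distr lborel borel (\<lambda>x. t + c *\<^sub>R x)) A = emeasure lborel {x. t + c *\<^sub>R x \<in> A}"
    by (subst emeasure_distr) (auto simp: vimage_def)
  finally show ?thesis .
qed

lemma AE_lborel_affine:
  fixes P :: "'a::euclidean_space \<Rightarrow> bool"
  assumes "AE x in lborel. P x" and c: "0 < c"
  shows "AE x in lborel. P (t + c *\<^sub>R x)"
proof -
  obtain N where N: "N \<in> null_sets lborel" "{x. \<not> P x} \<subseteq> N"
    using assms(1) by (auto simp: eventually_ae_filter)
  then have [measurable]: "N \<in> sets borel" by auto
  have "ennreal (c ^ DIM('a)) * emeasure lborel {x. t + c *\<^sub>R x \<in> N} = 0"
    using lborel_emeasure_affine[of N c t] N c by auto
  then have "{x. t + c *\<^sub>R x \<in> N} \<in> null_sets lborel"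
    using c by (auto simp: null_sets_def)
  then show ?thesis
    by (rule AE_I') (use N in auto)
qed

lemma test_fun_affine:
  assumes "test_fun \<phi>" "0 < c"
  shows "test_fun (\<lambda>x. \<phi> ((x - t) /\<^sub>R c))"
proof -
  obtain R where R: "\<And>x. R < norm x \<Longrightarrow> \<phi> x = 0" and c: "continuous_on UNIV \<phi>"
    using assms by (auto simp: test_fun_def)
  have "\<phi> ((x - t) /\<^sub>R c) = 0" if "c * R + norm t < norm x" for x
  proof (rule R)
    have "c * R < norm (x - t)" using that norm_triangle_ineq2[of x t] by simp
    moreover have "norm ((x - t) /\<^sub>R c) = norm (x - t) / c" using assms(2) by (simp add: divide_inverse)
    ultimately show "R < norm ((x - t) /\<^sub>R c)" using assms(2) by (simp add: pos_less_divide_eq mult.commute)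
  qed
  moreover have "continuous_on UNIV (\<lambda>x. \<phi> ((x - t) /\<^sub>R c))"
    by (rule continuous_on_compose2[OF c]) (auto intro!: continuous_intros)
  ultimately show ?thesis by (auto simp: test_fun_def)
qed

text \<open>Blowing up at \<open>t\<close> rescales lengths in source and target alike, so both
  Lipschitz constants survive. In the weak equation both sides pick up the same factor
  \<open>c ^ DIM('a)\<close>, which cancels.\<close>

lemma rescale_pair:
  fixes f g :: "'a::euclidean_space \<Rightarrow> 'a" and t :: 'a
  assumes p: "lip_pair K L f g" and r: "realizes g s" and c: "0 < c"
    and [measurable]: "s \<in> borel_measurable borel"
  defines "F \<equiv> \<lambda>x. (f (t + c *\<^sub>R x) - f t) /\<^sub>R c" and "G \<equiv> \<lambda>y. (g (f t + c *\<^sub>R y) - t) /\<^sub>R c"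
  shows "lip_pair K L F G" "F 0 = 0" "realizes G (\<lambda>x. s (t + c *\<^sub>R x))"
proof -
  note D = lip_pair_D[OF p]
  show "F 0 = 0" by (simp add: F_def)
  have aux: "norm (a /\<^sub>R c - b /\<^sub>R c) \<le> C * norm (x - y)"
    if "norm (a - b) \<le> C * norm (c *\<^sub>R x - c *\<^sub>R y)" for a b x y :: 'a and C
  proof -
    have "norm (a /\<^sub>R c - b /\<^sub>R c) = norm (a - b) / c"
      using c by (simp add: scaleR_diff_right[symmetric] divide_inverse)
    also have "\<dots> \<le> C * norm (c *\<^sub>R x - c *\<^sub>R y) / c"
      using that c by (intro divide_right_mono) auto
    also have "norm (c *\<^sub>R x - c *\<^sub>R y) = c * norm (x - y)"
      using c by (simp add: scaleR_diff_right[symmetric])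
    finally show ?thesis using c by simp
  qed
  show "lip_pair K L F G"
  proof (rule lip_pairI)
    show "dist (F x) (F y) \<le> K * dist x y" for x y
      unfolding F_def dist_norm
      using D(1)[of "t + c *\<^sub>R x" "t + c *\<^sub>R y"] by (intro aux) (simp add: dist_norm)
    show "dist (G x) (G y) \<le> L * dist x y" for x y
      unfolding G_def dist_norm
      using D(2)[of "f t + c *\<^sub>R x" "f t + c *\<^sub>R y"] by (intro aux) (simp add: dist_norm)
    show "G (F x) = x" "F (G x) = x" for x
      using c by (simp_all add: F_def G_def D)
  qed (use D in auto)
  show "realizes G (\<lambda>x. s (t + c *\<^sub>R x))"
    unfolding realizes_def
  proof (intro allI impI)
    fix \<phi> :: "'a \<Rightarrow> real" assume \<phi>: "test_fun \<phi>"
    note [measurable] = test_fun_borel[OF \<phi>]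
    have [measurable]: "g \<in> borel_measurable borel"
      using D(8) by (rule borel_measurable_continuous_onI)
    let ?\<psi> = "\<lambda>x. \<phi> ((x - t) /\<^sub>R c)"
    have "c ^ DIM('a) * (\<integral>y. \<phi> (G y) \<partial>lborel) = (\<integral>y. ?\<psi> (g y) \<partial>lborel)"
      unfolding G_def using c by (subst lborel_integral_affine[of _ c "f t"]) auto
    also have "\<dots> = (\<integral>x. ?\<psi> x * s x \<partial>lborel)"
      using r test_fun_affine[OF \<phi> c] by (auto simp: realizes_def)
    also have "\<dots> = c ^ DIM('a) * (\<integral>x. \<phi> x * s (t + c *\<^sub>R x) \<partial>lborel)"
      using c by (subst lborel_integral_affine[of _ c t]) auto
    finally show "(\<integral>y. \<phi> (G y) \<partial>lborel) = (\<integral>x. \<phi> x * s (t + c *\<^sub>R x) \<partial>lborel)"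
      using c by simp
  qed
qed

subsection \<open>Compactness\<close>

text \<open>The Arzela-Ascoli argument: a diagonal subsequence converges on a countable dense set,
  and the common Lipschitz constant makes the values Cauchy at every other point.\<close>

lemma lipschitz_convergent_subsequence:
  fixes f :: "nat \<Rightarrow> 'a::euclidean_space \<Rightarrow> 'a"
  assumes lip: "\<And>n x y. dist (f n x) (f n y) \<le> K * dist x y" and z: "\<And>n. f n 0 = 0" and K: "0 \<le> K"
  obtains r h where "strict_mono r" "\<And>x. (\<lambda>n. f (r n) x) \<longlonglongrightarrow> h x"
proof -
  obtain D :: "'a set" where D: "countable D" "\<And>X. open X \<Longrightarrow> X \<noteq> {} \<Longrightarrow> \<exists>d\<in>D. d \<in> X"
    using countable_dense_setE by metis
  \<comment> \<open>Dividing by \<open>1 + norm x\<close> turns the linear growth of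
    \<open>f n\<close> into a bound \<open>K\<close> uniform in \<open>x\<close>, as the diagonal
    extraction requires.\<close>
  define h where "h = (\<lambda>n x. f n x /\<^sub>R (1 + norm x))"
  have "norm (h n x) \<le> K" for n x
  proof -
    have "norm (f n x) \<le> K * norm x" using lip[of n x 0] z by (simp add: dist_norm)
    also have "\<dots> \<le> K * (1 + norm x)" using K by (simp add: mult_left_mono)
    finally show ?thesis by (simp add: h_def divide_inverse[symmetric] divide_le_eq add_pos_nonneg mult.commute)
  qed
  then obtain r where r: "strict_mono r" "\<And>x. x \<in> D \<Longrightarrow> \<exists>l. (\<lambda>n. h (r n) x) \<longlonglongrightarrow> l"
    using function_convergent_subsequence[OF D(1), of h K] by metis
  have conv: "Cauchy (\<lambda>n. f (r n) x)" if x: "x \<in> D" for x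
  proof -
    obtain l where "(\<lambda>n. h (r n) x) \<longlonglongrightarrow> l" using r x by blast
    then have "(\<lambda>n. (1 + norm x) *\<^sub>R h (r n) x) \<longlonglongrightarrow> (1 + norm x) *\<^sub>R l"
      by (intro tendsto_intros)
    moreover have "1 + norm x \<noteq> 0" using norm_ge_zero[of x] by linarith
    ultimately show ?thesis by (auto simp: h_def intro: LIMSEQ_imp_Cauchy)
  qed
  have "Cauchy (\<lambda>n. f (r n) x)" for x
  proof (rule metric_CauchyI)
    fix e :: real assume e: "0 < e"
    \<comment> \<open>The \<open>+ 1\<close> avoids division by zero when \<open>K = 0\<close> and
      still gives \<open>K * d \<le> e / 4\<close>.\<close>
    define d where "d = e / (4 * (K + 1))"
    have d: "0 < d" using e K by (simp add: d_def)
    have Kd: "K * d \<le> e / 4"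
    proof -
      have "K * d \<le> (K + 1) * d" using d by (simp add: mult_right_mono)
      also have "\<dots> = e / 4" using K by (simp add: d_def field_simps)
      finally show ?thesis .
    qed
    obtain q where q: "q \<in> D" "dist x q < d" using D(2)[of "ball x d"] d by auto
    have near: "dist (f n x) (f n q) \<le> e / 4" for n
      using lip[of n x q] mult_left_mono[of "dist x q" d K] q Kd K by linarith
    obtain N where N: "\<And>m n. m \<ge> N \<Longrightarrow> n \<ge> N \<Longrightarrow> dist (f (r m) q) (f (r n) q) < e / 4"
      using metric_CauchyD[OF conv[OF q(1)], of "e / 4"] e by auto
    show "\<exists>M. \<forall>m\<ge>M. \<forall>n\<ge>M. dist (f (r m) x) (f (r n) x) < e"
    proof (intro exI allI impI)
      fix m n assume "N \<le> m" "N \<le> n"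
      then show "dist (f (r m) x) (f (r n) x) < e"
        using N[of m n] near[of "r m"] near[of "r n"] e
          dist_triangle[of "f (r m) x" "f (r n) x" "f (r m) q"]
          dist_triangle[of "f (r m) q" "f (r n) x" "f (r n) q"]
        by (simp add: dist_commute)
    qed
  qed
  then have "\<forall>x. \<exists>l. (\<lambda>n. f (r n) x) \<longlonglongrightarrow> l"
    using Cauchy_convergent_iff convergent_def by blast
  then show ?thesis using r(1) that by metis
qed

text \<open>Subsequences of the maps and then of the inverses converge pointwise. The uniform
  Lipschitz bounds keep the limits mutually inverse, and dominated convergence carries the weak
  equation over.\<close>

theorem lip_pair_compactness:
  fixes f g :: "nat \<Rightarrow> 'a::euclidean_space \<Rightarrow> 'a"
  assumes p: "\<And>n. lip_pair K L (f n) (g n)" and z: "\<And>n. f n 0 = 0"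
    and re: "\<And>n. realizes (g n) (s n)"
    and lim: "\<And>\<phi>. test_fun \<phi> \<Longrightarrow> (\<lambda>n. \<integral>x. \<phi> x * s n x \<partial>lborel) \<longlonglongrightarrow> (\<integral>x. \<phi> x * s' x \<partial>lborel)"
  obtains r f' g' where "strict_mono r" "lip_pair K L f' g'" "\<And>x. (\<lambda>n. f (r n) x) \<longlonglongrightarrow> f' x"
    "f' 0 = 0" "realizes g' s'"
proof -
  note D = lip_pair_D[OF p]
  have gz: "g n 0 = 0" for n using D(3)[of n 0] z by simp
  obtain r1 f' where r1: "strict_mono r1" "\<And>x. (\<lambda>n. f (r1 n) x) \<longlonglongrightarrow> f' x"
    using lipschitz_convergent_subsequence[of f K] D z by metis
  obtain r2 g' where r2: "strict_mono r2" "\<And>x. (\<lambda>n. g (r1 (r2 n)) x) \<longlonglongrightarrow> g' x"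
    using lipschitz_convergent_subsequence[of "\<lambda>n. g (r1 n)" L] D gz by metis
  define r where "r = r1 \<circ> r2"
  have r: "strict_mono r" unfolding r_def using r1 r2 by (intro strict_mono_o)
  have fl: "(\<lambda>n. f (r n) x) \<longlonglongrightarrow> f' x" for x
    using LIMSEQ_subseq_LIMSEQ[OF r1(2) r2(1), of x] by (simp add: r_def o_def)
  have gl: "(\<lambda>n. g (r n) x) \<longlonglongrightarrow> g' x" for x
    using r2(2) by (simp add: r_def)
  have lipf: "dist (f' x) (f' y) \<le> K * dist x y" for x y
    by (rule tendsto_upperbound[OF tendsto_dist[OF fl[of x] fl[of y]]]) (use D in auto)
  have lipg: "dist (g' x) (g' y) \<le> L * dist x y" for x y
    by (rule tendsto_upperbound[OF tendsto_dist[OF gl[of x] gl[of y]]]) (use D in auto)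
  \<comment> \<open>Since \<open>f (r n)\<close> sends \<open>g (r n) y\<close> to \<open>y\<close>,
    its value at the nearby point \<open>g' y\<close> is within \<open>K\<close> times their
    distance of \<open>y\<close>.\<close>
  have "(\<lambda>n. dist (f (r n) (g' y)) y) \<longlonglongrightarrow> 0" for y
  proof (rule tendsto_sandwich[OF _ _ tendsto_const])
    have "(\<lambda>n. K * dist (g' y) (g (r n) y)) \<longlonglongrightarrow> K * dist (g' y) (g' y)"
      by (intro tendsto_intros gl)
    then show "(\<lambda>n. K * dist (g' y) (g (r n) y)) \<longlonglongrightarrow> 0" by simp
    show "\<forall>\<^sub>F n in sequentially. dist (f (r n) (g' y)) y \<le> K * dist (g' y) (g (r n) y)"
      using D(1)[of _ "g' y" "g _ y"] D(4) by (metis (mono_tags, lifting) always_eventually)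
  qed auto
  then have "(\<lambda>n. f (r n) (g' y)) \<longlonglongrightarrow> y" for y using tendsto_dist_iff by blast
  then have fg: "f' (g' y) = y" for y using LIMSEQ_unique[OF fl] by blast
  have "(\<lambda>n. dist (g (r n) (f' y)) y) \<longlonglongrightarrow> 0" for y
  proof (rule tendsto_sandwich[OF _ _ tendsto_const])
    have "(\<lambda>n. L * dist (f' y) (f (r n) y)) \<longlonglongrightarrow> L * dist (f' y) (f' y)"
      by (intro tendsto_intros fl)
    then show "(\<lambda>n. L * dist (f' y) (f (r n) y)) \<longlonglongrightarrow> 0" by simp
    show "\<forall>\<^sub>F n in sequentially. dist (g (r n) (f' y)) y \<le> L * dist (f' y) (f (r n) y)"
      using D(2)[of _ "f' y" "f _ y"] D(3) by (metis (mono_tags, lifting) always_eventually)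
  qed auto
  then have "(\<lambda>n. g (r n) (f' y)) \<longlonglongrightarrow> y" for y using tendsto_dist_iff by blast
  then have gf: "g' (f' y) = y" for y using LIMSEQ_unique[OF gl] by blast
  have pair: "lip_pair K L f' g'"
    using lipf lipg fg gf D by (intro lip_pairI) auto
  have f0: "f' 0 = 0" using fl[of 0] z by (simp add: LIMSEQ_const_iff)
  have "realizes g' s'"
    unfolding realizes_def
  proof (intro allI impI)
    fix \<phi> :: "'a \<Rightarrow> real" assume \<phi>: "test_fun \<phi>"
    note [measurable] = test_fun_borel[OF \<phi>]
    have cont: "continuous_on UNIV \<phi>" using \<phi> by (simp add: test_fun_def)
    have [measurable]: "g n \<in> borel_measurable borel" "g' \<in> borel_measurable borel" for n
      using D lip_pair_D(8)[OF pair] by (auto intro: borel_measurable_continuous_onI)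
    obtain B R where BR: "0 < B" "\<And>x. \<bar>\<phi> x\<bar> \<le> B" "\<And>x. R < norm x \<Longrightarrow> \<phi> x = 0"
      using test_fun_bounded[OF \<phi>] by metis
    \<comment> \<open>A common majorant exists because \<open>y\<close> is the image of
      \<open>g (r n) y\<close> under a \<open>K\<close>-Lipschitz map fixing 0: if
      \<open>g (r n) y\<close> lies in the ball of radius \<open>R\<close>, then
      \<open>norm y \<le> K * R\<close>.\<close>
    have "(\<lambda>n. \<integral>y. \<phi> (g (r n) y) \<partial>lborel) \<longlonglongrightarrow> (\<integral>y. \<phi> (g' y) \<partial>lborel)"
    proof (rule integral_dominated_convergence[where w = "\<lambda>x. B * indicat_real (cball 0 (K * R)) x"])
      show "AE y in lborel. (\<lambda>n. \<phi> (g (r n) y)) \<longlonglongrightarrow> \<phi> (g' y)"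
        using continuous_on_tendsto_compose[OF cont gl] by auto
      show "AE y in lborel. norm (\<phi> (g (r n) y)) \<le> B * indicat_real (cball 0 (K * R)) y" for n
      proof (rule AE_I2)
        fix y
        have "\<phi> (g (r n) y) = 0" if "y \<notin> cball 0 (K * R)"
        proof (rule BR(3), rule ccontr)
          assume "\<not> R < norm (g (r n) y)"
          then have "K * norm (g (r n) y) \<le> K * R" using D(5) by (intro mult_left_mono) auto
          moreover have "norm y \<le> K * norm (g (r n) y)"
            using D(1)[of "r n" "g (r n) y" 0] D(4) z by (simp add: dist_norm)
          ultimately show False using that by auto
        qed
        then show "norm (\<phi> (g (r n) y)) \<le> B * indicat_real (cball 0 (K * R)) y"
          using BR(2) by (auto simp: indicator_def)
      qed
    qed (simp_all add: integrable_indicat_cball del: Bochner_Integration.integrable_mult_right_iff integrable_mult_left_iff integrable_indicator_iff)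
    moreover have "(\<integral>y. \<phi> (g (r n) y) \<partial>lborel) = (\<integral>x. \<phi> x * s (r n) x \<partial>lborel)" for n
      using re \<phi> by (auto simp: realizes_def)
    moreover have "(\<lambda>n. \<integral>x. \<phi> x * s (r n) x \<partial>lborel) \<longlonglongrightarrow> (\<integral>x. \<phi> x * s' x \<partial>lborel)"
      using LIMSEQ_subseq_LIMSEQ[OF lim[OF \<phi>] r] by (simp add: o_def)
    ultimately show "(\<integral>y. \<phi> (g' y) \<partial>lborel) = (\<integral>x. \<phi> x * s' x \<partial>lborel)"
      using LIMSEQ_unique by fastforce
  qed
  then show ?thesis using that r pair fl f0 by blast
qed

subsection \<open>Convergence of densities\<close>

text \<open>Dominated convergence on the support of \<open>\<phi>\<close>. The bound on
  \<open>s n\<close> is only local because members of \<open>Cplus\<close> may be unbounded.\<close>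

lemma tendsto_test_integral_AE:
  fixes s :: "nat \<Rightarrow> 'a::euclidean_space \<Rightarrow> real"
  assumes \<phi>: "test_fun \<phi>" and [measurable]: "\<And>n. s n \<in> borel_measurable borel" "s' \<in> borel_measurable borel"
    and bd: "\<And>R. \<exists>B. \<forall>n. AE x in lborel. norm x \<le> R \<longrightarrow> \<bar>s n x\<bar> \<le> B"
    and lim: "AE x in lborel. (\<lambda>n. s n x) \<longlonglongrightarrow> s' x"
  shows "(\<lambda>n. \<integral>x. \<phi> x * s n x \<partial>lborel) \<longlonglongrightarrow> (\<integral>x. \<phi> x * s' x \<partial>lborel)"
proof -
  note [measurable] = test_fun_borel[OF \<phi>]
  obtain C R where CR: "0 < C" "\<And>x. \<bar>\<phi> x\<bar> \<le> C" "\<And>x. R < norm x \<Longrightarrow> \<phi> x = 0"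
    using test_fun_bounded[OF \<phi>] by metis
  obtain B where B: "\<And>n. AE x in lborel. norm x \<le> R \<longrightarrow> \<bar>s n x\<bar> \<le> B" using bd[of R] by blast
  show ?thesis
  proof (rule integral_dominated_convergence[where w = "\<lambda>x. (C * B) * indicat_real (cball 0 R) x"])
    show "AE x in lborel. (\<lambda>n. \<phi> x * s n x) \<longlonglongrightarrow> \<phi> x * s' x"
      using lim by eventually_elim (intro tendsto_intros)
    show "AE x in lborel. norm (\<phi> x * s n x) \<le> (C * B) * indicat_real (cball 0 R) x" for n
      using B[of n]
    proof eventually_elim
      case (elim x)
      show ?case
      proof (cases "norm x \<le> R")
        case True
        then have "\<bar>\<phi> x\<bar> * \<bar>s n x\<bar> \<le> C * B" using elim CR by (intro mult_mono) auto
        then show ?thesis using True by (simp add: abs_mult)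
      qed (use CR in auto)
    qed
  qed (simp_all add: integrable_indicat_cball del: Bochner_Integration.integrable_mult_right_iff integrable_mult_left_iff integrable_indicator_iff)
qed

text \<open>The integrands agree off the exceptional set, and on it they differ by at most
  \<open>C * (2 * B)\<close>.\<close>

lemma test_integral_diff_le:
  fixes s s' :: "'a::euclidean_space \<Rightarrow> real"
  assumes \<phi>: "test_fun \<phi>" and C: "\<And>x. \<bar>\<phi> x\<bar> \<le> C" and R: "\<And>x. R < norm x \<Longrightarrow> \<phi> x = 0"
    and [measurable]: "s \<in> borel_measurable borel" "s' \<in> borel_measurable borel"
    and bd: "AE x in lborel. \<bar>s x\<bar> \<le> B" "AE x in lborel. \<bar>s' x\<bar> \<le> B" and "0 \<le> B"
    and em: "emeasure lborel {x \<in> cball 0 R. s x \<noteq> s' x} \<le> ennreal e" and e: "0 \<le> e"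
  shows "\<bar>(\<integral>x. \<phi> x * s x \<partial>lborel) - (\<integral>x. \<phi> x * s' x \<partial>lborel)\<bar> \<le> 2 * C * B * e"
proof -
  note [measurable] = test_fun_borel[OF \<phi>]
  let ?A = "{x \<in> cball 0 R. s x \<noteq> s' x}"
  have C0: "0 \<le> C" using C[of 0] by linarith
  have iA: "integrable lborel (\<lambda>x. 2 * C * B * indicat_real ?A x)"
    using em by (intro integrable_mult_right integrable_real_indicator) (auto simp: order_le_less_trans)
  have i: "integrable lborel (\<lambda>x. \<phi> x * t x)"
    if [measurable]: "t \<in> borel_measurable borel" and "AE x in lborel. \<bar>t x\<bar> \<le> B" for t
  proof (rule integrable_bounded_support[where B = "C * B" and R = R])
    show "AE x in lborel. \<bar>\<phi> x * t x\<bar> \<le> C * B"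
      using that(2) by eventually_elim (use C C0 in \<open>auto simp: abs_mult intro!: mult_mono\<close>)
  qed (auto simp: R)
  have "(\<integral>x. \<phi> x * s x \<partial>lborel) - (\<integral>x. \<phi> x * s' x \<partial>lborel) = (\<integral>x. \<phi> x * s x - \<phi> x * s' x \<partial>lborel)"
    using i bd by (subst Bochner_Integration.integral_diff) auto
  also have "\<bar>\<dots>\<bar> \<le> (\<integral>x. \<bar>\<phi> x * s x - \<phi> x * s' x\<bar> \<partial>lborel)"
    by (rule integral_abs_bound)
  also have "\<dots> \<le> (\<integral>x. 2 * C * B * indicat_real ?A x \<partial>lborel)"
  proof (rule integral_mono_AE)
    show "AE x in lborel. \<bar>\<phi> x * s x - \<phi> x * s' x\<bar> \<le> 2 * C * B * indicat_real ?A x"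
      using bd
    proof eventually_elim
      case (elim x)
      have "\<bar>\<phi> x * s x - \<phi> x * s' x\<bar> = \<bar>\<phi> x\<bar> * \<bar>s x - s' x\<bar>"
        by (simp add: abs_mult[symmetric] right_diff_distrib)
      also have "\<dots> \<le> C * (2 * B)"
        using elim C C0 by (intro mult_mono) auto
      finally have "\<bar>\<phi> x * s x - \<phi> x * s' x\<bar> \<le> 2 * C * B" by simp
      then show ?case using R[of x] by (auto simp: indicator_def)
    qed
    show "integrable lborel (\<lambda>x. \<bar>\<phi> x * s x - \<phi> x * s' x\<bar>)"
      using i bd by (intro integrable_abs Bochner_Integration.integrable_diff) auto
  qed (rule iA)
  also have "\<dots> = 2 * C * B * measure lborel ?A"
    by simp
  also have "\<dots> \<le> 2 * C * B * e"
    using em e C0 \<open>0 \<le> B\<close> by (intro mult_left_mono) (auto simp: measure_def enn2real_leI)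
  finally show ?thesis .
qed

text \<open>In the applications two sequences agree, up to small sets, on balls whose radii tend to
  infinity; eventually such a ball contains the support of \<open>\<phi>\<close>.\<close>

lemma test_integral_diff_tendsto_0:
  fixes s s' :: "nat \<Rightarrow> 'a::euclidean_space \<Rightarrow> real"
  assumes \<phi>: "test_fun \<phi>"
    and m: "\<And>n. s n \<in> borel_measurable borel" "\<And>n. s' n \<in> borel_measurable borel"
    and bd: "\<And>n. AE x in lborel. \<bar>s n x\<bar> \<le> B" "\<And>n. AE x in lborel. \<bar>s' n x\<bar> \<le> B" and B: "0 \<le> B"
    and em: "\<And>n. emeasure lborel {x \<in> cball 0 (r n). s n x \<noteq> s' n x} \<le> ennreal (e n)" "\<And>n. 0 \<le> e n"
    and r: "filterlim r at_top sequentially" and e: "e \<longlonglongrightarrow> 0"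
  shows "(\<lambda>n. (\<integral>x. \<phi> x * s n x \<partial>lborel) - (\<integral>x. \<phi> x * s' n x \<partial>lborel)) \<longlonglongrightarrow> 0"
proof -
  obtain C R where CR: "0 < C" "\<And>x. \<bar>\<phi> x\<bar> \<le> C" "\<And>x. R < norm x \<Longrightarrow> \<phi> x = 0"
    using test_fun_bounded[OF \<phi>] by metis
  show ?thesis
  proof (rule Lim_null_comparison)
    show "(\<lambda>n. 2 * C * B * e n) \<longlonglongrightarrow> 0"
      using tendsto_mult_right_zero[OF e] by simp
    have "\<forall>\<^sub>F n in sequentially. R \<le> r n"
      using r by (simp add: filterlim_at_top)
    then show "\<forall>\<^sub>F n in sequentially. norm ((\<integral>x. \<phi> x * s n x \<partial>lborel) - (\<integral>x. \<phi> x * s' n x \<partial>lborel)) \<le> 2 * C * B * e n"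
    proof eventually_elim
      case (elim n)
      have "\<phi> x = 0" if "r n < norm x" for x using CR(3)[of x] that elim by simp
      then show ?case
        using test_integral_diff_le[OF \<phi> CR(2) _ m bd B em] by simp
    qed
  qed
qed

section \<open>Maximally stretched lines\<close>

text \<open>By the equality cases of the parallelogram law and of Cauchy-Schwarz, the stretched line
  is mapped to a line at constant speed. Comparing any \<open>p\<close> with points far out on that
  line determines \<open>F p \<bullet> V\<close>, and the equality case used once more gives the
  translation rule.\<close>

lemma translation_equivariant_if_stretches_line:
  fixes F :: "'a::euclidean_space \<Rightarrow> 'a"
  assumes lip: "\<And>x y. dist (F x) (F y) \<le> \<Lambda> * dist x y" and z: "F 0 = 0"
    and u: "norm u = 1" and \<Lambda>: "0 \<le> \<Lambda>"
    and st: "\<And>t. 0 < t \<Longrightarrow> 2 * t * \<Lambda> \<le> dist (F (t *\<^sub>R u)) (F ((- t) *\<^sub>R u))"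
  obtains V where "\<And>p t. F (p + t *\<^sub>R u) = F p + t *\<^sub>R V"
proof -
  have uu: "u \<bullet> u = 1" using u by (simp add: norm_eq_1)
  \<comment> \<open>Equality case of Cauchy-Schwarz: the assumptions force the squared norm of
    \<open>w - t *\<^sub>R V\<close> to be at most 0.\<close>
  have eqv: "w = t *\<^sub>R V" if "norm w \<le> \<Lambda> * \<bar>t\<bar>" "w \<bullet> V = t * \<Lambda>\<^sup>2" "V \<bullet> V = \<Lambda>\<^sup>2" for w V :: 'a and t
  proof -
    have "(norm w)\<^sup>2 \<le> (\<Lambda> * \<bar>t\<bar>)\<^sup>2" using that(1) by (intro power_mono) auto
    then have "w \<bullet> w \<le> \<Lambda>\<^sup>2 * t\<^sup>2" by (simp add: dot_square_norm power_mult_distrib)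
    moreover have "(w - t *\<^sub>R V) \<bullet> (w - t *\<^sub>R V) = w \<bullet> w - 2 * (t * (w \<bullet> V)) + t\<^sup>2 * (V \<bullet> V)"
      by (simp add: inner_diff_left inner_diff_right inner_commute power2_eq_square algebra_simps)
    moreover have "t * (w \<bullet> V) = \<Lambda>\<^sup>2 * t\<^sup>2" "t\<^sup>2 * (V \<bullet> V) = \<Lambda>\<^sup>2 * t\<^sup>2"
      using that(2,3) by (simp_all add: power2_eq_square)
    ultimately have "(w - t *\<^sub>R V) \<bullet> (w - t *\<^sub>R V) \<le> 0"
      by linarith
    then show ?thesis by (metis inner_ge_zero inner_eq_zero_iff order_antisym right_minus_eq)
  qed
  define V where "V = F u"
  have nF: "norm (F x) \<le> \<Lambda> * norm x" for x using lip[of x 0] z by (simp add: dist_norm)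
  \<comment> \<open>Two vectors of norm at most \<open>\<Lambda> * t\<close> whose difference has
    norm at least \<open>2 * t * \<Lambda>\<close> are opposite and of full length, by the
    parallelogram law.\<close>
  have anti: "F ((- t) *\<^sub>R u) = - F (t *\<^sub>R u) \<and> F (t *\<^sub>R u) \<bullet> F (t *\<^sub>R u) = \<Lambda>\<^sup>2 * t\<^sup>2" if t: "0 < t" for t
  proof -
    let ?p = "F (t *\<^sub>R u)" and ?q = "F ((- t) *\<^sub>R u)"
    have "norm ?p \<le> \<Lambda> * t" "norm ?q \<le> \<Lambda> * t" using nF[of "t *\<^sub>R u"] nF[of "(- t) *\<^sub>R u"] u t by auto
    then have "(norm ?p)\<^sup>2 \<le> (\<Lambda> * t)\<^sup>2" "(norm ?q)\<^sup>2 \<le> (\<Lambda> * t)\<^sup>2" by (auto intro: power_mono)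
    moreover have "(2 * t * \<Lambda>)\<^sup>2 \<le> (norm (?p - ?q))\<^sup>2"
      using st[OF t] t \<Lambda> by (intro power_mono) (auto simp: dist_norm)
    moreover have "(norm (?p - ?q))\<^sup>2 + (norm (?p + ?q))\<^sup>2 = 2 * (norm ?p)\<^sup>2 + 2 * (norm ?q)\<^sup>2"
      by (simp add: power2_norm_eq_inner inner_diff_left inner_diff_right inner_add_left inner_add_right)
    moreover have "(2 * t * \<Lambda>)\<^sup>2 = 4 * (\<Lambda> * t)\<^sup>2" by (simp add: power_mult_distrib)
    moreover have "0 \<le> (norm (?p + ?q))\<^sup>2" by simp
    ultimately have "(norm (?p + ?q))\<^sup>2 = 0" "(norm ?p)\<^sup>2 = (\<Lambda> * t)\<^sup>2" by linarith+
    then have "?p + ?q = 0" "?p \<bullet> ?p = \<Lambda>\<^sup>2 * t\<^sup>2"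
      by (simp_all add: power2_norm_eq_inner power_mult_distrib)
    then show ?thesis by (simp add: add_eq_0_iff2 minus_unique)
  qed
  have VV: "V \<bullet> V = \<Lambda>\<^sup>2" using anti[of 1] by (simp add: V_def)
  have pos: "F (t *\<^sub>R u) = t *\<^sub>R V" if t: "0 < t" for t
  proof (rule eqv[OF _ _ VV])
    show "norm (F (t *\<^sub>R u)) \<le> \<Lambda> * \<bar>t\<bar>" using nF[of "t *\<^sub>R u"] u by simp
    \<comment> \<open>The distance to \<open>V = F u\<close> bounds the inner product from below,
      Cauchy-Schwarz bounds it from above, and the two bounds coincide.\<close>
    have "(dist (F (t *\<^sub>R u)) V)\<^sup>2 \<le> (\<Lambda> * \<bar>t - 1\<bar>)\<^sup>2"
    proof (rule power_mono)
      have "dist (t *\<^sub>R u) u = \<bar>t - 1\<bar>"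
        using u norm_scaleR[of "t - 1" u] by (simp add: dist_norm scaleR_diff_left)
      then show "dist (F (t *\<^sub>R u)) V \<le> \<Lambda> * \<bar>t - 1\<bar>" using lip[of "t *\<^sub>R u" u] by (simp add: V_def)
    qed auto
    moreover have "(dist (F (t *\<^sub>R u)) V)\<^sup>2 = \<Lambda>\<^sup>2 * t\<^sup>2 - 2 * (F (t *\<^sub>R u) \<bullet> V) + \<Lambda>\<^sup>2"
      using anti[OF t] VV
      by (simp add: dist_norm power2_norm_eq_inner inner_diff_left inner_diff_right inner_commute)
    ultimately have lo: "t * \<Lambda>\<^sup>2 \<le> F (t *\<^sub>R u) \<bullet> V"
      by (simp add: power_mult_distrib) (simp add: power2_eq_square algebra_simps)
    have "F (t *\<^sub>R u) \<bullet> V \<le> norm (F (t *\<^sub>R u)) * norm V" by (rule norm_cauchy_schwarz)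
    also have "\<dots> \<le> (\<Lambda> * t) * \<Lambda>"
      using nF[of "t *\<^sub>R u"] nF[of u] u t \<Lambda> by (intro mult_mono) (auto simp: V_def)
    finally show "F (t *\<^sub>R u) \<bullet> V = t * \<Lambda>\<^sup>2" using lo by (simp add: power2_eq_square algebra_simps)
  qed
  have Ft: "F (t *\<^sub>R u) = t *\<^sub>R V" for t
  proof (cases t "0::real" rule: linorder_cases)
    case less
    then show ?thesis using anti[of "- t"] pos[of "- t"] by simp
  qed (use pos z in auto)
  have inn: "F p \<bullet> V = \<Lambda>\<^sup>2 * (p \<bullet> u)" for p
  proof -
    define c where "c = \<Lambda>\<^sup>2 * (p \<bullet> p) - F p \<bullet> F p"
    define d where "d = F p \<bullet> V - \<Lambda>\<^sup>2 * (p \<bullet> u)"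
    \<comment> \<open>When the Lipschitz bound between \<open>p\<close> and
      \<open>t *\<^sub>R u\<close> is squared, the terms quadratic in \<open>t\<close> cancel. What
      remains is a linear function of \<open>t\<close> bounded above on the whole line, so its slope
      vanishes.\<close>
    have *: "- (2 * t * d) \<le> c" for t
    proof -
      have "(dist (F p) (t *\<^sub>R V))\<^sup>2 \<le> (\<Lambda> * dist p (t *\<^sub>R u))\<^sup>2"
        using lip[of p "t *\<^sub>R u"] by (intro power_mono) (auto simp: Ft)
      then have "F p \<bullet> F p - 2 * t * (F p \<bullet> V) + t\<^sup>2 * \<Lambda>\<^sup>2 \<le> \<Lambda>\<^sup>2 * (p \<bullet> p - 2 * t * (p \<bullet> u) + t\<^sup>2)"
        using VV uu
        by (simp add: power_mult_distrib dist_norm power2_norm_eq_inner inner_diff_left inner_diff_right inner_commute)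
           (simp add: power2_eq_square algebra_simps)
      then show ?thesis by (simp add: c_def d_def algebra_simps)
    qed
    have "d = 0"
    proof (rule ccontr)
      assume "d \<noteq> 0"
      then show False using *[of "- ((c + 1) / (2 * d))"] by simp
    qed
    then show ?thesis by (simp add: d_def)
  qed
  have "F (p + t *\<^sub>R u) = F p + t *\<^sub>R V" for p t
  proof -
    have "F (p + t *\<^sub>R u) - F p = t *\<^sub>R V"
    proof (rule eqv[OF _ _ VV])
      show "norm (F (p + t *\<^sub>R u) - F p) \<le> \<Lambda> * \<bar>t\<bar>"
        using lip[of "p + t *\<^sub>R u" p] u by (simp add: dist_norm)
      show "(F (p + t *\<^sub>R u) - F p) \<bullet> V = t * \<Lambda>\<^sup>2"
        using uu by (simp add: inner_diff_left inn inner_add_left algebra_simps)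
    qed
    then show ?thesis by (simp add: algebra_simps)
  qed
  then show ?thesis using that by blast
qed

text \<open>Only the direction of \<open>u\<close> enters, and the pattern is invariant under
  positive scaling of \<open>x\<close>. It jumps across the hyperplane orthogonal to
  \<open>u\<close>, hence across the line that gets stretched.\<close>

definition half_pattern :: "real \<Rightarrow> real \<Rightarrow> 'a::euclidean_space \<Rightarrow> 'a \<Rightarrow> real" where
  "half_pattern a b u x = (if x \<bullet> u < 0 then a else b)"

lemma half_pattern_measurable [measurable]: "half_pattern a b u \<in> borel_measurable borel"
  unfolding half_pattern_def by measurable

text \<open>The inverse \<open>G\<close> turns translation by \<open>t *\<^sub>R V\<close> into
  translation by \<open>t *\<^sub>R u\<close>. Lebesgue measure is invariant under the former, so
  the realized density integrates equally against a bump and against its translate, even if they lie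
  on different sides of the jump.\<close>

lemma half_pattern_not_realized_if_stretches_line:
  fixes F G :: "'a::euclidean_space \<Rightarrow> 'a"
  assumes p: "lip_pair \<Lambda> L F G" and z: "F 0 = 0" and u: "norm u = 1"
    and st: "\<And>t. 0 < t \<Longrightarrow> 2 * t * \<Lambda> \<le> dist (F (t *\<^sub>R u)) (F ((- t) *\<^sub>R u))"
    and r: "realizes G (half_pattern a b u)"
  shows "a = b"
proof -
  note D = lip_pair_D[OF p]
  obtain V where V: "\<And>p t. F (p + t *\<^sub>R u) = F p + t *\<^sub>R V"
    using translation_equivariant_if_stretches_line[of F \<Lambda> u] D z u st by metis
  have G: "G (y + t *\<^sub>R V) = G y + t *\<^sub>R u" for y t
    using D(3,4) V[of "G y" t] by metis
  \<comment> \<open>The bump \<open>\<phi>\<close> lives in the unit ball about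
    \<open>2 *\<^sub>R u\<close>, where the density is \<open>b\<close>; \<open>\<psi>\<close> is
    its translate about \<open>- 2 *\<^sub>R u\<close>, where the density is
    \<open>a\<close>.\<close>
  define \<phi> where "\<phi> = (\<lambda>x::'a. max 0 (1 - dist x (2 *\<^sub>R u)))"
  define \<psi> where "\<psi> = (\<lambda>x. \<phi> (x + 4 *\<^sub>R u))"
  have c: "continuous_on UNIV \<phi>" unfolding \<phi>_def by (intro continuous_intros)
  have supp: "\<bar>x \<bullet> u - 2\<bar> < 1" if "\<phi> x \<noteq> 0" for x
  proof -
    have "(x - 2 *\<^sub>R u) \<bullet> u = x \<bullet> u - 2" using u by (simp add: inner_diff_left norm_eq_1)
    moreover have "\<bar>(x - 2 *\<^sub>R u) \<bullet> u\<bar> \<le> norm (x - 2 *\<^sub>R u) * norm u" by (rule Cauchy_Schwarz_ineq2)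
    ultimately show ?thesis using that u by (auto simp: \<phi>_def dist_norm max_def split: if_splits)
  qed
  have t\<phi>: "test_fun \<phi>"
    unfolding test_fun_def
  proof (intro conjI c exI allI impI)
    fix x :: 'a assume "3 < norm x"
    then show "\<phi> x = 0" using norm_triangle_ineq2[of x "2 *\<^sub>R u"] u by (simp add: \<phi>_def dist_norm)
  qed
  have t\<psi>: "test_fun \<psi>"
    using test_fun_affine[OF t\<phi>, of 1 "- 4 *\<^sub>R u"] by (simp add: \<psi>_def)
  note [measurable] = test_fun_borel[OF t\<phi>] test_fun_borel[OF t\<psi>]
  have [measurable]: "G \<in> borel_measurable borel"
    using D(8) by (rule borel_measurable_continuous_onI)
  have sh: "(\<integral>x. h x \<partial>lborel) = (\<integral>x. h (t + x) \<partial>lborel)"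
    if "h \<in> borel_measurable borel" for h :: "'a \<Rightarrow> real" and t
    using lborel_integral_affine[OF that, of 1 t] by simp
  have "b * (\<integral>x. \<phi> x \<partial>lborel) = (\<integral>x. \<phi> x * half_pattern a b u x \<partial>lborel)"
    unfolding Bochner_Integration.integral_mult_right_zero[symmetric]
    by (rule Bochner_Integration.integral_cong) (use supp in \<open>force simp: half_pattern_def\<close>)+
  also have "\<dots> = (\<integral>y. \<phi> (G y) \<partial>lborel)" using r t\<phi> by (simp add: realizes_def)
  also have "\<dots> = (\<integral>y. \<phi> (G (4 *\<^sub>R V + y)) \<partial>lborel)" by (rule sh) measurable
  also have "\<dots> = (\<integral>y. \<psi> (G y) \<partial>lborel)" by (simp add: \<psi>_def G add.commute[of "4 *\<^sub>R V"])
  also have "\<dots> = (\<integral>x. \<psi> x * half_pattern a b u x \<partial>lborel)" using r t\<psi> by (simp add: realizes_def)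
  also have "\<dots> = (\<integral>x. a * \<psi> x \<partial>lborel)"
  proof (rule Bochner_Integration.integral_cong)
    fix x
    show "\<psi> x * half_pattern a b u x = a * \<psi> x"
      using supp[of "x + 4 *\<^sub>R u"] u
      by (cases "\<psi> x = 0") (auto simp: half_pattern_def \<psi>_def inner_add_left norm_eq_1)
  qed simp
  also have "\<dots> = a * (\<integral>x. \<phi> x \<partial>lborel)"
    using sh[of \<phi> "4 *\<^sub>R u"] by (simp add: \<psi>_def add.commute)
  finally have "b * (\<integral>x. \<phi> x \<partial>lborel) = a * (\<integral>x. \<phi> x \<partial>lborel)" .
  moreover have "0 < (\<integral>x. \<phi> x \<partial>lborel)"
  proof -
    have i\<phi>: "integrable lborel \<phi>"
      using test_fun_bounded[OF t\<phi>] by (metis AE_I2 integrable_bounded_support test_fun_borel t\<phi>)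
    have "0 < 1/2 * measure lborel (ball (2 *\<^sub>R u) (1/2))"
      by (simp add: content_ball_pos)
    also have "\<dots> = (\<integral>x. 1/2 * indicat_real (ball (2 *\<^sub>R u) (1/2)) x \<partial>lborel)"
      by simp
    also have "\<dots> \<le> (\<integral>x. \<phi> x \<partial>lborel)"
    proof (rule integral_mono[OF _ i\<phi>])
      show "integrable lborel (\<lambda>x. 1/2 * indicat_real (ball (2 *\<^sub>R u) (1/2)) x)"
        by (intro integrable_mult_right integrable_real_indicator emeasure_bounded_finite[OF bounded_ball]) simp
      show "1/2 * indicat_real (ball (2 *\<^sub>R u) (1/2)) x \<le> \<phi> x" for x
        by (auto simp: \<phi>_def indicator_def dist_commute)
    qed
    finally show ?thesis .
  qed
  ultimately show ?thesis by simp
qed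

section \<open>Densities between two constants are not uniformly realizable\<close>

definition density_between :: "real \<Rightarrow> real \<Rightarrow> (real^2 \<Rightarrow> real) \<Rightarrow> bool" where
  "density_between a b s \<longleftrightarrow> s \<in> borel_measurable borel \<and> (\<forall>x. a \<le> s x \<and> s x \<le> b)"

definition realizable :: "real \<Rightarrow> real \<Rightarrow> (real^2 \<Rightarrow> real) \<Rightarrow> bool" where
  "realizable K L s \<longleftrightarrow> (\<exists>f g. lip_pair K L f g \<and> realizes g s)"

abbreviation discrepancy :: "(real^2 \<Rightarrow> real) \<Rightarrow> (real^2 \<Rightarrow> real) \<Rightarrow> ennreal" where
  "discrepancy s s' \<equiv> emeasure lborel {x. s x \<noteq> s' x}"

lemma realizable_mono: "realizable K L s \<Longrightarrow> K \<le> K' \<Longrightarrow> L \<le> L' \<Longrightarrow> realizable K' L' s"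
  unfolding realizable_def using lip_pair_mono by blast

lemma discrepancy_triangle:
  assumes [measurable]: "s \<in> borel_measurable borel" "s' \<in> borel_measurable borel" "s'' \<in> borel_measurable borel"
  shows "discrepancy s s'' \<le> discrepancy s s' + discrepancy s' s''"
proof -
  have "discrepancy s s'' \<le> emeasure lborel ({x. s x \<noteq> s' x} \<union> {x. s' x \<noteq> s'' x})"
    by (intro emeasure_mono) auto
  also have "\<dots> \<le> discrepancy s s' + discrepancy s' s''"
    by (intro emeasure_subadditive) auto
  finally show ?thesis .
qed

text \<open>Compactness asks for maps fixing 0. This is the blow-up at 0 with factor 1, a mere
  translation of the target.\<close>

lemma normalized_pair:
  assumes "lip_pair K L f g" "realizes g s" "s \<in> borel_measurable borel"
  shows "lip_pair K L (\<lambda>x. f x - f 0) (\<lambda>y. g (f 0 + y))" "realizes (\<lambda>y. g (f 0 + y)) s"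
  using rescale_pair[OF assms(1,2), of 1 0] assms(3) by simp_all

lemma realizable_limit:
  fixes s :: "nat \<Rightarrow> real^2 \<Rightarrow> real"
  assumes re: "\<And>n. realizable K L (s n)" and m: "\<And>n. s n \<in> borel_measurable borel"
    and lim: "\<And>\<phi>. test_fun \<phi> \<Longrightarrow> (\<lambda>n. \<integral>x. \<phi> x * s n x \<partial>lborel) \<longlonglongrightarrow> (\<integral>x. \<phi> x * s' x \<partial>lborel)"
  shows "realizable K L s'"
proof -
  obtain f g where fg: "\<And>n. lip_pair K L (f n) (g n)" "\<And>n. realizes (g n) (s n)"
    using re unfolding realizable_def by metis
  show ?thesis
    by (rule lip_pair_compactness[of K L "\<lambda>n x. f n x - f n 0" "\<lambda>n y. g n (f n 0 + y)" s s'])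
       (use normalized_pair[OF fg m] lim in \<open>auto simp: realizable_def\<close>)
qed

lemma realizable_rescale:
  assumes "realizable K L s" "0 < c" "s \<in> borel_measurable borel"
  shows "realizable K L (\<lambda>x. s (t + c *\<^sub>R x))"
  using assms rescale_pair[of K L _ _ s c t] unfolding realizable_def by blast

section \<open>Compactness reduces stretching to finitely many segments\<close>

text \<open>Otherwise, along an enumeration of the pairs from a countable dense set, densities ever
  closer to \<open>s0\<close> would have realizations stretching none of the first pairs by more
  than \<open>K1\<close>. A limit of them would realize \<open>s0\<close> and be
  \<open>K1\<close>-Lipschitz. The set \<open>P\<close> is fixed before \<open>s\<close>,
  \<open>f\<close> and \<open>g\<close>, which allows patterns to be planted in advance.\<close>

lemma finite_stretched_pairs:
  assumes s0: "density_between a b s0" and a: "0 \<le> a" and K1: "0 \<le> K1"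
    and nr: "\<not> realizable K1 L s0"
  obtains P \<epsilon> where "finite P" "0 < \<epsilon>" "\<forall>(x, y) \<in> P. x \<noteq> y"
    "\<forall>s f g. density_between a b s \<and> discrepancy s s0 \<le> ennreal \<epsilon> \<and> lip_pair K L f g \<and> realizes g s
       \<longrightarrow> (\<exists>(x, y) \<in> P. K1 * dist x y < dist (f x) (f y))"
proof -
  obtain D :: "(real^2) set" where D: "countable D" "\<And>X. open X \<Longrightarrow> X \<noteq> {} \<Longrightarrow> \<exists>d\<in>D. d \<in> X"
    using countable_dense_setE by metis
  have cD: "closure D = UNIV"
    proof -
    have "D \<inter> S \<noteq> {}" if "open S" "x \<in> S" for x S using D(2)[of S] that by blast
    then show ?thesis unfolding closure_iff_nhds_not_empty set_eq_iff by blast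
  qed
  have DD: "countable (D \<times> D)" "D \<times> D \<noteq> {}" using D(1) D(2)[of UNIV] by auto
  define P where "P = (\<lambda>n. {p \<in> from_nat_into (D \<times> D) ` {..n}. fst p \<noteq> snd p})"
  have "\<exists>n. \<forall>s f g. density_between a b s \<longrightarrow> discrepancy s s0 \<le> ennreal (1 / real (Suc n)) \<longrightarrow>
        lip_pair K L f g \<longrightarrow> realizes g s \<longrightarrow> (\<exists>(x, y) \<in> P n. K1 * dist x y < dist (f x) (f y))"
  proof (rule ccontr)
    assume "\<not> ?thesis"
    then have ex: "\<forall>n. \<exists>s f g. density_between a b s \<and> discrepancy s s0 \<le> ennreal (1 / real (Suc n)) \<and>
        lip_pair K L f g \<and> realizes g s \<and> (\<forall>(x, y) \<in> P n. dist (f x) (f y) \<le> K1 * dist x y)"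
      (is "\<forall>n. \<exists>s f g. ?Q n s f g") by (simp add: not_less case_prod_beta)
    define Q where "Q = ?Q"
    have "\<forall>n. \<exists>s f g. Q n s f g" using ex by (simp add: Q_def)
    then obtain s f g where Q: "\<And>n. Q n (s n) (f n) (g n)" by metis
    then have *: "\<And>n. density_between a b (s n)"
        "\<And>n. discrepancy (s n) s0 \<le> ennreal (1 / real (Suc n))"
        "\<And>n. lip_pair K L (f n) (g n)" "\<And>n. realizes (g n) (s n)"
        "\<And>n. \<forall>(x, y) \<in> P n. dist (f n x) (f n y) \<le> K1 * dist x y"
      by (auto simp: Q_def)
    have m: "s n \<in> borel_measurable borel" "s0 \<in> borel_measurable borel" for n
      using *(1) s0 by (auto simp: density_between_def)
    have lim: "(\<lambda>n. \<integral>x. \<phi> x * s n x \<partial>lborel) \<longlonglongrightarrow> (\<integral>x. \<phi> x * s0 x \<partial>lborel)" if \<phi>: "test_fun \<phi>" for \<phi>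
    proof -
      have ab: "\<bar>t x\<bar> \<le> b" if "density_between a b t" for t x
        using that a by (auto simp: density_between_def abs_le_iff intro: order_trans[of _ 0])
          (smt (verit))
      have "(\<lambda>n. (\<integral>x. \<phi> x * s n x \<partial>lborel) - (\<integral>x. \<phi> x * s0 x \<partial>lborel)) \<longlonglongrightarrow> 0"
      proof (rule test_integral_diff_tendsto_0[OF \<phi>, where B = b and r = real and e = "\<lambda>n. 1 / real (Suc n)"])
        show "0 \<le> b" using ab[OF s0, of 0] by linarith
        show "emeasure lborel {x \<in> cball 0 (real n). s n x \<noteq> s0 x} \<le> ennreal (1 / real (Suc n))" for n
          using m by (intro order_trans[OF emeasure_mono *(2)]) auto
        show "filterlim real at_top sequentially" by (rule filterlim_real_sequentially)
        show "(\<lambda>n. 1 / real (Suc n)) \<longlonglongrightarrow> 0"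
          using LIMSEQ_inverse_real_of_nat by (simp add: inverse_eq_divide)
      qed (use m ab *(1) s0 in auto)
      then show ?thesis by (simp add: LIM_zero_iff)
    qed
    obtain r f' g' where r: "strict_mono r" and f': "lip_pair K L f' g'" "realizes g' s0"
        "\<And>x. (\<lambda>n. f (r n) x - f (r n) 0) \<longlonglongrightarrow> f' x"
      by (rule lip_pair_compactness[of K L "\<lambda>n x. f n x - f n 0" "\<lambda>n y. g n (f n 0 + y)" s s0])
         (use normalized_pair[OF *(3,4) m(1)] lim in auto)
    \<comment> \<open>A pair of distinct points with index \<open>k\<close> lies in
      \<open>P (r n)\<close> for all \<open>n \<ge> k\<close>, since
      \<open>k \<le> n \<le> r n\<close>; so its bound holds along a tail and in the limit.\<close>
    have onD: "dist (f' x) (f' y) \<le> K1 * dist x y" if xy: "x \<in> D" "y \<in> D" for x y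
    proof (rule tendsto_upperbound[OF tendsto_dist[OF f'(3)[of x] f'(3)[of y]]])
      obtain k where k: "from_nat_into (D \<times> D) k = (x, y)"
        using from_nat_into_surj[OF DD(1), of "(x, y)"] xy by auto
      have "dist (f (r n) x) (f (r n) y) \<le> K1 * dist x y" if n: "k \<le> n" for n
      proof (cases "x = y")
        case False
        have "k \<le> r n" using seq_suble[OF r, of n] n by linarith
        then have "(x, y) \<in> P (r n)" using k False by (force simp: P_def)
        then show ?thesis using *(5)[of "r n"] by auto
      qed simp
      then show "\<forall>\<^sub>F n in sequentially. dist (f (r n) x - f (r n) 0) (f (r n) y - f (r n) 0) \<le> K1 * dist x y"
        by (auto simp: eventually_sequentially dist_norm)
    qed simp
    have "dist (f' x) (f' y) \<le> K1 * dist x y" for x y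
    proof -
      obtain X Y where XY: "\<And>n. X n \<in> D" "X \<longlonglongrightarrow> x" "\<And>n. Y n \<in> D" "Y \<longlonglongrightarrow> y"
        using cD closure_sequential[of x D] closure_sequential[of y D] by auto
      have c: "continuous_on UNIV f'" by (rule lip_pair_D(7)[OF f'(1)])
      show ?thesis
      proof (rule LIMSEQ_le)
        show "(\<lambda>n. dist (f' (X n)) (f' (Y n))) \<longlonglongrightarrow> dist (f' x) (f' y)"
          by (intro tendsto_intros continuous_on_tendsto_compose[OF c] XY) auto
        show "(\<lambda>n. K1 * dist (X n) (Y n)) \<longlonglongrightarrow> K1 * dist x y"
          by (intro tendsto_intros XY)
      qed (use onD XY in auto)
    qed
    then have "lip_pair K1 L f' g'"
      using lip_pair_D[OF f'(1)] K1 by (intro lip_pairI) auto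
    then show False using nr f'(2) by (auto simp: realizable_def)
  qed
  then obtain n where "\<And>s f g. density_between a b s \<Longrightarrow> discrepancy s s0 \<le> ennreal (1 / real (Suc n)) \<Longrightarrow>
        lip_pair K L f g \<Longrightarrow> realizes g s \<Longrightarrow> (\<exists>(x, y) \<in> P n. K1 * dist x y < dist (f x) (f y))"
    by blast
  then show ?thesis
    by (intro that[of "P n" "1 / real (Suc n)"]) (auto simp: P_def)
qed

subsection \<open>Planting half-plane patterns along a segment\<close>

definition segment_mid :: "real^2 \<Rightarrow> real^2 \<Rightarrow> nat \<Rightarrow> nat \<Rightarrow> real^2" where
  "segment_mid x y M i = x + ((real i + 1/2) / real M) *\<^sub>R (y - x)"

text \<open>The ball has the \<open>i\<close>-th of the \<open>M\<close> equal pieces of the segment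
  as a diameter.\<close>

definition pattern_defect :: "real \<Rightarrow> real \<Rightarrow> real^2 \<Rightarrow> real^2 \<Rightarrow> nat \<Rightarrow> (real^2 \<Rightarrow> real) \<Rightarrow> nat \<Rightarrow> (real^2) set" where
  "pattern_defect a b x y M s i = {z \<in> ball (segment_mid x y M i) (dist x y / (2 * real M)).
      s z \<noteq> half_pattern a b (y - x) (z - segment_mid x y M i)}"

text \<open>The defect is compared with the squared length of a piece, so that the condition gives
  the same bound after a piece is blown up, whatever \<open>M\<close> is.\<close>

definition patterned :: "real \<Rightarrow> real \<Rightarrow> real \<Rightarrow> real^2 \<Rightarrow> real^2 \<Rightarrow> (real^2 \<Rightarrow> real) \<Rightarrow> bool" where
  "patterned a b \<eta> x y s \<longleftrightarrow> (\<exists>M\<ge>1. \<forall>i<M.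
      emeasure lborel (pattern_defect a b x y M s i) \<le> ennreal (\<eta> * (dist x y / real M)\<^sup>2))"

text \<open>The \<open>M\<close> balls have total area
  \<open>pi * len\<^sup>2 / (4 * real M)\<close>, which tends to 0 as \<open>M\<close> grows. This
  is where dimension two enters: overwriting the density around the whole segment is cheap.\<close>

lemma exact_pattern:
  assumes s: "density_between a b s" and ab: "a \<le> b" and xy: "x \<noteq> y" and \<epsilon>: "0 < \<epsilon>"
  obtains M s' where "1 \<le> M" "density_between a b s'" "discrepancy s' s \<le> ennreal \<epsilon>"
    "\<And>i. i < M \<Longrightarrow> pattern_defect a b x y M s' i = {}"
proof -
  define len where "len = dist x y"
  have len: "0 < len" using xy by (simp add: len_def)
  obtain M :: nat where M: "pi * len\<^sup>2 / \<epsilon> < real M" using reals_Archimedean2 by blast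
  have M0: "0 < real M"
    by (rule le_less_trans[OF _ M]) (use \<epsilon> in simp)
  define h where "h = len / real M"
  have h: "0 < h" using len M0 by (simp add: h_def)
  define B where "B = (\<Union>i<M. ball (segment_mid x y M i) (h / 2))"
  text \<open>One formula serves all balls, as the pattern is periodic along the segment.\<close>
  define pt where "pt = (\<lambda>z. if frac (((z - x) \<bullet> (y - x)) * real M / len\<^sup>2) < 1/2 then a else b)"
  define s' where "s' = (\<lambda>z. if z \<in> B then pt z else s z)"
  have [measurable]: "s \<in> borel_measurable borel" using s by (simp add: density_between_def)
  have [measurable]: "B \<in> sets borel" by (auto simp: B_def)
  have [measurable]: "pt \<in> borel_measurable borel" unfolding pt_def frac_def by measurable
  have "s' \<in> borel_measurable borel" unfolding s'_def by measurable
  then have "density_between a b s'"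
    using s ab by (auto simp: density_between_def s'_def pt_def)
  moreover have "discrepancy s' s \<le> ennreal \<epsilon>"
  proof -
    have "discrepancy s' s \<le> emeasure lborel B"
      by (intro emeasure_mono) (auto simp: s'_def)
    also have "\<dots> \<le> (\<Sum>i<M. emeasure lborel (ball (segment_mid x y M i) (h / 2)))"
      unfolding B_def by (rule emeasure_subadditive_finite) auto
    also have "\<dots> = (\<Sum>i<M. ennreal (pi * (h / 2)\<^sup>2))"
      using h by (intro sum.cong refl) (simp add: emeasure_ball unit_ball_vol_2)
    also have "\<dots> = ennreal (real M * (pi * (h / 2)\<^sup>2))"
      by (simp add: ennreal_of_nat_eq_real_of_nat ennreal_mult'')
    also have "\<dots> \<le> ennreal \<epsilon>"
    proof (rule ennreal_leI)
      have "real M * (pi * (h / 2)\<^sup>2) = (pi * len\<^sup>2 / real M) / 4"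
        using M0 by (simp add: h_def power2_eq_square field_simps)
      also have "\<dots> \<le> pi * len\<^sup>2 / real M"
      proof -
        have "0 \<le> pi * len\<^sup>2 / real M" by simp
        moreover have "t / 4 \<le> t" if "0 \<le> t" for t :: real using that by simp
        ultimately show ?thesis by blast
      qed
      also have "\<dots> \<le> \<epsilon>" using M M0 \<epsilon> by (simp add: field_simps)
      finally show "real M * (pi * (h / 2)\<^sup>2) \<le> \<epsilon>" .
    qed
    finally show ?thesis .
  qed
  moreover have "pattern_defect a b x y M s' i = {}" if i: "i < M" for i
  proof -
    have "s' z = half_pattern a b (y - x) (z - segment_mid x y M i)"
      if z: "z \<in> ball (segment_mid x y M i) (h / 2)" for z
    proof -
      let ?m = "segment_mid x y M i"
      \<comment> \<open>\<open>q\<close> is the signed offset from the midpoint along the segment,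
        in units of the piece length. Inside the ball it is below \<open>1/2\<close> in absolute
        value, so the fractional part in \<open>pt\<close> is \<open>q + 1/2\<close>, and this is
        below \<open>1/2\<close> exactly when \<open>q < 0\<close>.\<close>
      define q where "q = ((z - ?m) \<bullet> (y - x)) * real M / len\<^sup>2"
      have ll: "(y - x) \<bullet> (y - x) = len\<^sup>2"
        unfolding len_def dist_commute[of x y] by (simp add: dist_norm power2_norm_eq_inner)
      have "z - x = (z - ?m) + ((real i + 1/2) / real M) *\<^sub>R (y - x)" by (simp add: segment_mid_def)
      then have "(z - x) \<bullet> (y - x) = (z - ?m) \<bullet> (y - x) + (real i + 1/2) / real M * len\<^sup>2"
        by (metis inner_add_left inner_scaleR_left ll)
      then have e: "((z - x) \<bullet> (y - x)) * real M / len\<^sup>2 = q + real i + 1/2"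
        using M0 len by (simp add: q_def add_divide_distrib distrib_right)
      have "\<bar>(z - ?m) \<bullet> (y - x)\<bar> \<le> norm (z - ?m) * norm (y - x)" by (rule Cauchy_Schwarz_ineq2)
      also have "\<dots> < h / 2 * len"
      proof -
        have "norm (y - x) = len" by (simp add: len_def dist_norm norm_minus_commute)
        moreover have "norm (z - ?m) < h / 2" using z by (simp add: dist_norm norm_minus_commute)
        ultimately show ?thesis using len by simp
      qed
      finally have "\<bar>(z - ?m) \<bullet> (y - x)\<bar> * (real M / len\<^sup>2) < h / 2 * len * (real M / len\<^sup>2)"
        using M0 len by (intro mult_strict_right_mono) auto
      also have "\<dots> = 1/2" using M0 len by (simp add: h_def power2_eq_square)
      finally have q: "\<bar>q\<bar> < 1/2" using M0 len by (simp add: q_def abs_mult)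
      have "frac (q + real i + 1/2) = q + 1/2"
        using q by (subst frac_unique_iff) (auto simp: algebra_simps)
      moreover have "q < 0 \<longleftrightarrow> (z - ?m) \<bullet> (y - x) < 0"
        using M0 len by (simp add: q_def divide_less_0_iff mult_less_0_iff)
      ultimately have "pt z = half_pattern a b (y - x) (z - ?m)"
        by (simp add: pt_def e half_pattern_def)
      moreover have "z \<in> B" using z i by (auto simp: B_def)
      ultimately show ?thesis by (simp add: s'_def)
    qed
    then show ?thesis by (auto simp: pattern_defect_def h_def len_def)
  qed
  ultimately show ?thesis using that[of M s'] M0 by simp
qed

text \<open>The segments are treated one after another. Planting a pattern on a new segment may
  spoil earlier ones, so every stage also records a tolerance, and the next change is kept below
  it.\<close>

lemma robust_pattern:
  assumes P: "finite P" "\<And>x y. (x, y) \<in> P \<Longrightarrow> x \<noteq> y" and s: "density_between a b s"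
    and ab: "a \<le> b" and \<epsilon>: "0 < \<epsilon>" and \<eta>: "0 < \<eta>"
  shows "\<exists>s'. density_between a b s' \<and> discrepancy s' s \<le> ennreal \<epsilon> \<and>
     (\<exists>\<delta>>0. \<forall>s''. density_between a b s'' \<longrightarrow> discrepancy s'' s' \<le> ennreal \<delta> \<longrightarrow>
        (\<forall>(x, y)\<in>P. patterned a b \<eta> x y s''))"
  using P s \<epsilon>
proof (induction arbitrary: \<epsilon> rule: finite_induct)
  case empty
  then show ?case by (intro exI[of _ s]) (auto intro!: exI[of _ 1])
next
  case (insert p P)
  obtain x y where p: "p = (x, y)" by (cases p)
  have xy: "x \<noteq> y" using insert.prems p by auto
  obtain s1 \<delta>1 where s1: "density_between a b s1" "discrepancy s1 s \<le> ennreal (\<epsilon> / 2)" "0 < \<delta>1"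
      "\<And>s''. density_between a b s'' \<Longrightarrow> discrepancy s'' s1 \<le> ennreal \<delta>1 \<Longrightarrow>
        (\<forall>(x, y)\<in>P. patterned a b \<eta> x y s'')"
    using insert.IH[of "\<epsilon> / 2"] insert.prems by auto
  obtain M s2 where s2: "1 \<le> M" "density_between a b s2"
      "discrepancy s2 s1 \<le> ennreal (min (\<epsilon> / 2) (\<delta>1 / 2))"
      "\<And>i. i < M \<Longrightarrow> pattern_defect a b x y M s2 i = {}"
    using exact_pattern[OF s1(1) ab xy, of "min (\<epsilon> / 2) (\<delta>1 / 2)"] s1(3) insert.prems by auto
  \<comment> \<open>Half of \<open>\<delta>1\<close> is spent on passing from \<open>s1\<close> to
    \<open>s2\<close>, half is left for later changes. The second term is the allowance of the new
    segment, whose pattern is exact in \<open>s2\<close>.\<close>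
  define \<delta> where "\<delta> = min (\<delta>1 / 2) (\<eta> * (dist x y / real M)\<^sup>2)"
  have m: "t \<in> borel_measurable borel" if "density_between a b t" for t
    using that by (simp add: density_between_def)
  have \<delta>: "0 < \<delta>" using s1(3) \<eta> xy s2(1) by (simp add: \<delta>_def)
  show ?case
  proof (intro exI[of _ s2] exI[of _ \<delta>] conjI allI impI ballI)
    show "density_between a b s2" "0 < \<delta>" by fact+
    have "discrepancy s2 s \<le> discrepancy s2 s1 + discrepancy s1 s"
      by (intro discrepancy_triangle m) (use s1 s2 insert.prems in auto)
    also have "\<dots> \<le> ennreal (\<epsilon> / 2) + ennreal (\<epsilon> / 2)"
      using s1(2) by (intro add_mono order_trans[OF s2(3)] ennreal_leI) auto
    also have "\<dots> = ennreal \<epsilon>" using insert.prems by (simp flip: ennreal_plus)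
    finally show "discrepancy s2 s \<le> ennreal \<epsilon>" .
    fix s'' q assume s'': "density_between a b s''" "discrepancy s'' s2 \<le> ennreal \<delta>" and q: "q \<in> insert p P"
    note [measurable] = m[OF s''(1)] m[OF s2(2)]
    have "discrepancy s'' s1 \<le> discrepancy s'' s2 + discrepancy s2 s1"
      by (intro discrepancy_triangle m) (use s1 s2 s'' in auto)
    also have "\<dots> \<le> ennreal (\<delta>1 / 2) + ennreal (\<delta>1 / 2)"
      by (intro add_mono order_trans[OF s2(3)] order_trans[OF s''(2)] ennreal_leI) (auto simp: \<delta>_def)
    also have "\<dots> = ennreal \<delta>1" using s1(3) by (simp flip: ennreal_plus)
    finally have "\<forall>(x, y)\<in>P. patterned a b \<eta> x y s''" using s1(4) s''(1) by blast
    moreover have "patterned a b \<eta> x y s''"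
      unfolding patterned_def
    proof (intro exI[of _ M] conjI allI impI s2(1))
      fix i assume "i < M"
      then have "pattern_defect a b x y M s'' i \<subseteq> {x. s'' x \<noteq> s2 x}"
        using s2(4)[of i] by (auto simp: pattern_defect_def)
      then have "emeasure lborel (pattern_defect a b x y M s'' i) \<le> discrepancy s'' s2"
        by (intro emeasure_mono) auto
      also have "\<dots> \<le> ennreal (\<eta> * (dist x y / real M)\<^sup>2)"
        using s''(2) by (rule order_trans) (simp add: \<delta>_def ennreal_leI)
      finally show "emeasure lborel (pattern_defect a b x y M s'' i) \<le> ennreal (\<eta> * (dist x y / real M)\<^sup>2)" .
    qed
    ultimately show "case q of (x, y) \<Rightarrow> patterned a b \<eta> x y s''" using q p by auto
  qed
qed

subsection \<open>Blowing up an almost maximally stretched segment\<close>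

lemma dist_chain_le:
  fixes q :: "nat \<Rightarrow> 'a::metric_space"
  shows "dist (q 0) (q M) \<le> (\<Sum>i<M. dist (q i) (q (Suc i)))"
proof (induction M)
  case (Suc M)
  then show ?case using dist_triangle[of "q 0" "q (Suc M)" "q M"] by simp
qed simp

text \<open>Patterns are planted on all finitely many candidate segments before a realization is
  picked. Whichever segment it stretches, the triangle inequality passes the stretch on to one
  piece, and the blow-up carries that piece to the segment between \<open>(- n) *\<^sub>R u\<close>
  and \<open>n *\<^sub>R u\<close>.\<close>

lemma blow_up_stretched_piece:
  assumes ab: "0 \<le> a" "a \<le> b" and K1: "0 \<le> K1" and \<eta>: "0 < \<eta>" and n: "0 < n"
    and all: "\<And>s. density_between a b s \<Longrightarrow> realizable K L s"
    and nr: "density_between a b s0" "\<not> realizable K1 L s0"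
  obtains u F G s where "norm u = 1" "lip_pair K L F G" "F 0 = 0" "density_between a b s" "realizes G s"
    "emeasure lborel {z \<in> ball 0 n. s z \<noteq> half_pattern a b u z} \<le> ennreal (4 * n\<^sup>2 * \<eta>)"
    "2 * n * K1 \<le> dist (F (n *\<^sub>R u)) (F ((- n) *\<^sub>R u))"
proof -
  obtain P \<epsilon> where P0: "finite P" "0 < \<epsilon>" "\<forall>(x, y) \<in> P. x \<noteq> y"
    "\<forall>s f g. density_between a b s \<and> discrepancy s s0 \<le> ennreal \<epsilon> \<and> lip_pair K L f g \<and> realizes g s
       \<longrightarrow> (\<exists>(x, y) \<in> P. K1 * dist x y < dist (f x) (f y))"
    using finite_stretched_pairs[OF nr(1) ab(1) K1 nr(2), where K = K] .
  have ne': "\<And>x y. (x, y) \<in> P \<Longrightarrow> x \<noteq> y" using P0(3) by auto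
  obtain s \<delta> where s: "density_between a b s" "discrepancy s s0 \<le> ennreal \<epsilon>" and "0 < \<delta>"
     "\<And>s''. density_between a b s'' \<Longrightarrow> discrepancy s'' s \<le> ennreal \<delta> \<Longrightarrow> \<forall>(x, y)\<in>P. patterned a b \<eta> x y s''"
    using robust_pattern[OF P0(1) ne' nr(1) ab(2) P0(2) \<eta>] by blast
  from this(4)[OF s(1)] have pat: "\<And>x y. (x, y) \<in> P \<Longrightarrow> patterned a b \<eta> x y s" by auto
  have [measurable]: "s \<in> borel_measurable borel" using s by (simp add: density_between_def)
  obtain f g where fg: "lip_pair K L f g" "realizes g s"
    using all[OF s(1)] by (auto simp: realizable_def)
  obtain x y where xy: "(x, y) \<in> P" "K1 * dist x y < dist (f x) (f y)"
    using P0(4) s fg by blast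
  have ne: "x \<noteq> y" using ne' xy by blast
  obtain M where M: "1 \<le> M"
     "\<And>i. i < M \<Longrightarrow> emeasure lborel (pattern_defect a b x y M s i) \<le> ennreal (\<eta> * (dist x y / real M)\<^sup>2)"
    using pat[OF xy(1)] by (auto simp: patterned_def)
  define h where "h = dist x y / real M"
  have h: "0 < h" using ne M by (simp add: h_def)
  define q where "q = (\<lambda>i::nat. x + (real i / real M) *\<^sub>R (y - x))"
  have "\<exists>i<M. K1 * h < dist (f (q i)) (f (q (Suc i)))"
  proof (rule ccontr)
    assume "\<not> ?thesis"
    then have le: "\<And>i. i < M \<Longrightarrow> dist (f (q i)) (f (q (Suc i))) \<le> K1 * h" by (meson not_less)
    have "dist (f (q 0)) (f (q M)) \<le> (\<Sum>i<M. dist (f (q i)) (f (q (Suc i))))" by (rule dist_chain_le)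
    also have "\<dots> \<le> (\<Sum>i<M. K1 * h)" using le by (intro sum_mono) auto
    also have "\<dots> = K1 * dist x y" using M by (simp add: h_def)
    finally show False using xy(2) M by (simp add: q_def)
  qed
  then obtain i where i: "i < M" "K1 * h < dist (f (q i)) (f (q (Suc i)))" by blast
  define m where "m = segment_mid x y M i"
  define u where "u = (y - x) /\<^sub>R dist x y"
  \<comment> \<open>A piece of length \<open>h\<close> becomes one of length \<open>2 * n\<close>,
    so areas are divided by \<open>c\<^sup>2\<close> and the defect bound
    \<open>\<eta> * h\<^sup>2\<close> becomes \<open>4 * n\<^sup>2 * \<eta>\<close>.\<close>
  define c where "c = h / (2 * n)"
  have c: "0 < c" using h n by (simp add: c_def)
  have u: "norm u = 1" using ne by (simp add: u_def dist_norm norm_minus_commute)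
  have yx: "y - x = dist x y *\<^sub>R u" using ne by (simp add: u_def)
  have q: "m + c *\<^sub>R (n *\<^sub>R u) = q (Suc i)" "m + c *\<^sub>R ((- n) *\<^sub>R u) = q i"
    using n M by (simp_all add: m_def q_def segment_mid_def yx c_def h_def algebra_simps add_divide_distrib
        flip: scaleR_add_left)
  define F where "F = (\<lambda>x. (f (m + c *\<^sub>R x) - f m) /\<^sub>R c)"
  define G where "G = (\<lambda>y. (g (f m + c *\<^sub>R y) - m) /\<^sub>R c)"
  define s' where "s' = (\<lambda>x. s (m + c *\<^sub>R x))"
  have FG: "lip_pair K L F G" "F 0 = 0" "realizes G s'"
    using rescale_pair[OF fg c, of m] by (simp_all add: F_def G_def s'_def)
  show ?thesis
  proof (rule that[OF u FG(1,2) _ FG(3)])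
    show "density_between a b s'" using s(1) by (auto simp: density_between_def s'_def)
    have "dist (F (n *\<^sub>R u)) (F ((- n) *\<^sub>R u)) = dist (f (q i)) (f (q (Suc i))) / c"
      unfolding F_def q using c
      by (simp add: dist_norm scaleR_diff_right[symmetric] norm_minus_commute divide_inverse)
    moreover have "K1 * h / c \<le> dist (f (q i)) (f (q (Suc i))) / c"
      using i(2) c by (intro divide_right_mono) auto
    moreover have "K1 * h / c = 2 * n * K1" using h n by (simp add: c_def field_simps)
    ultimately show "2 * n * K1 \<le> dist (F (n *\<^sub>R u)) (F ((- n) *\<^sub>R u))" by simp
    let ?A = "pattern_defect a b x y M s i"
    have [measurable]: "?A \<in> sets borel" unfolding pattern_defect_def by measurable
    have "{z. m + c *\<^sub>R z \<in> ?A} = {z \<in> ball 0 n. s' z \<noteq> half_pattern a b u z}"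
    proof -
      have "c * norm z < h / 2 \<longleftrightarrow> norm z < n" for z :: "real^2"
        using h n by (simp add: c_def field_simps)
      moreover have "half_pattern a b (y - x) (c *\<^sub>R z) = half_pattern a b u z" for z
        using c ne by (simp add: half_pattern_def yx mult_less_0_iff)
      ultimately show ?thesis
        using c by (auto simp: pattern_defect_def s'_def dist_norm h_def m_def[symmetric] mult.commute[of 2 "real M"])
    qed
    then have "ennreal (c\<^sup>2) * emeasure lborel {z \<in> ball 0 n. s' z \<noteq> half_pattern a b u z} = emeasure lborel ?A"
      using lborel_emeasure_affine[of ?A c m] c by simp
    also have "\<dots> \<le> ennreal (\<eta> * h\<^sup>2)" using M(2)[OF i(1)] by (simp add: h_def)
    also have "\<eta> * h\<^sup>2 = c\<^sup>2 * (4 * n\<^sup>2 * \<eta>)" using n by (simp add: c_def power2_eq_square)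
    also have "ennreal \<dots> = ennreal (c\<^sup>2) * ennreal (4 * n\<^sup>2 * \<eta>)" by (simp add: ennreal_mult')
    finally show "emeasure lborel {z \<in> ball 0 n. s' z \<noteq> half_pattern a b u z} \<le> ennreal (4 * n\<^sup>2 * \<eta>)"
      using c by (subst (asm) ennreal_mult_le_mult_iff) auto
  qed
qed

section \<open>The extremal Lipschitz constant and the limit of the blow-ups\<close>

text \<open>Off the null hyperplane orthogonal to \<open>u'\<close>, the sign of
  \<open>x \<bullet> u n\<close> is eventually that of \<open>x \<bullet> u'\<close>, so the values
  are eventually constant.\<close>

lemma tendsto_half_pattern:
  fixes u :: "nat \<Rightarrow> 'a::euclidean_space"
  assumes u: "u \<longlonglongrightarrow> u'" and u': "u' \<noteq> 0"
  shows "AE x in lborel. (\<lambda>n. half_pattern a b (u n) x) \<longlonglongrightarrow> half_pattern a b u' x"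
proof -
  have "{x. u' \<bullet> x = 0} \<in> null_sets lebesgue"
    using negligible_hyperplane[of u' 0] u' by (simp add: negligible_iff_null_sets)
  then have "{x. u' \<bullet> x = 0} \<in> null_sets lborel"
    by (subst (asm) null_sets_completion_iff) (auto simp: closed_hyperplane borel_closed)
  then have "AE x in lborel. x \<notin> {x. u' \<bullet> x = 0}" by (rule AE_not_in)
  then show ?thesis
  proof eventually_elim
    case (elim x)
    have l: "(\<lambda>n. x \<bullet> u n) \<longlonglongrightarrow> x \<bullet> u'" by (intro tendsto_intros u)
    have "\<forall>\<^sub>F n in sequentially. half_pattern a b (u n) x = half_pattern a b u' x"
    proof (cases "x \<bullet> u' < 0")
      case True
      from order_tendstoD(2)[OF l True] show ?thesis
        by (rule eventually_mono) (use True in \<open>simp add: half_pattern_def\<close>)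
    next
      case False
      then have "0 < x \<bullet> u'" using elim by (auto simp: inner_commute)
      from order_tendstoD(1)[OF l this] show ?thesis
        by (rule eventually_mono) (use False in \<open>simp add: half_pattern_def\<close>)
    qed
    then show ?case by (rule tendsto_eventually)
  qed
qed

text \<open>The infimum \<open>\<Lambda>\<close> may fail to be attained, so the argument runs along
  blow-ups with Lipschitz constant \<open>\<Lambda> + d n\<close> and stretch
  \<open>\<Lambda> - d n\<close> on segments of growing length. Exact stretching appears only in the
  limit.\<close>

theorem not_all_realizable:
  assumes ab: "0 < a" "a < b"
  shows "\<exists>s. density_between a b s \<and> \<not> realizable K L s"
proof (rule ccontr)
  assume "\<not> ?thesis"
  then have KL: "\<And>s. density_between a b s \<Longrightarrow> realizable K L s" by blast
  define T where "T = {K. \<forall>s. density_between a b s \<longrightarrow> realizable K L s}"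
  \<comment> \<open>As \<open>g\<close> inverts \<open>f\<close>, two points at distance 1 force
    \<open>1 \<le> L * K'\<close>; this keeps the infimum positive.\<close>
  have low: "0 < K' \<and> 0 < L \<and> 1 / L \<le> K'" if K': "K' \<in> T" for K'
  proof -
    have "density_between a b (\<lambda>_. a)" using ab by (auto simp: density_between_def)
    then obtain f g :: "real^2 \<Rightarrow> real^2" where p: "lip_pair K' L f g" using K' unfolding T_def realizable_def by blast
    note D = lip_pair_D[OF p]
    have "(1::real) = dist 0 (axis 1 1 :: real^2)" by simp
    also have "\<dots> = dist (g (f 0)) (g (f (axis 1 1)))" by (simp only: D)
    also have "\<dots> \<le> L * dist (f 0) (f (axis 1 1))" by (rule D)
    also have "\<dots> \<le> L * (K' * dist 0 (axis 1 1 :: real^2))" by (intro mult_left_mono D)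
    finally have "1 \<le> L * K'" by simp
    then show ?thesis using D(5,6) by (auto simp: divide_le_eq mult.commute less_le)
  qed
  have KT: "K \<in> T" using KL by (simp add: T_def)
  define \<Lambda> where "\<Lambda> = Inf T"
  have bdd: "bdd_below T" using low by (meson bdd_belowI less_imp_le)
  have "1 / L \<le> \<Lambda>" unfolding \<Lambda>_def using KT low by (intro cInf_greatest) auto
  then have \<Lambda>: "0 < \<Lambda>" using low[OF KT] by (auto intro: less_le_trans[of 0 "1 / L"])
  \<comment> \<open>Quadratic decay makes \<open>N n * d n\<close>, the order of the total error
    over a segment of length \<open>2 * N n\<close>, tend to 0. Moreover
    \<open>d n \<le> \<Lambda>\<close>, so \<open>\<Lambda> - d n\<close> is nonnegative.\<close>
  define d where "d = (\<lambda>n::nat. \<Lambda> / (real n + 2)\<^sup>2)"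
  have d: "0 < d n" "d n \<le> \<Lambda>" for n
  proof -
    have "1 \<le> (real n + 2)\<^sup>2" by (intro one_le_power) auto
    then show "d n \<le> \<Lambda>" using \<Lambda> mult_left_mono[of 1 "(real n + 2)\<^sup>2" \<Lambda>] by (simp add: d_def divide_le_eq)
    show "0 < d n" using \<Lambda> by (auto simp: d_def add_pos_pos intro!: divide_pos_pos zero_less_power)
  qed
  have up: "realizable (\<Lambda> + d n) L s" if s: "density_between a b s" for s n
  proof -
    obtain K' where "K' \<in> T" "K' < \<Lambda> + d n"
      using cInf_lessD[of T "\<Lambda> + d n"] KT d(1)[of n] by (auto simp: \<Lambda>_def)
    then show ?thesis using s realizable_mono[of K' L s "\<Lambda> + d n" L] by (auto simp: T_def)
  qed
  have dn: "\<exists>s0. density_between a b s0 \<and> \<not> realizable (\<Lambda> - d n) L s0" for n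
  proof (rule ccontr)
    assume "\<not> ?thesis"
    then have "\<Lambda> - d n \<in> T" by (auto simp: T_def)
    then have "\<Lambda> \<le> \<Lambda> - d n" unfolding \<Lambda>_def using bdd by (intro cInf_lower)
    then show False using d(1)[of n] by simp
  qed
  define N where "N = (\<lambda>n. real (Suc n))"
  \<comment> \<open>Cubic decay turns the defect bound \<open>4 * (N n)\<^sup>2 * \<eta> n\<close>
    after the blow-up into \<open>4 / N n\<close>, which vanishes in the limit.\<close>
  define \<eta> where "\<eta> = (\<lambda>n. 1 / N n ^ 3)"
  have N: "0 < N n" "0 < \<eta> n" for n by (auto simp: N_def \<eta>_def)
  define Q where "Q = (\<lambda>n u F G s. norm u = 1 \<and> lip_pair (\<Lambda> + d n) L F G \<and> F 0 = 0 \<and>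
    density_between a b s \<and> realizes G s \<and>
    emeasure lborel {z \<in> ball 0 (N n). s z \<noteq> half_pattern a b u z} \<le> ennreal (4 * (N n)\<^sup>2 * \<eta> n) \<and>
    2 * N n * (\<Lambda> - d n) \<le> dist (F (N n *\<^sub>R u)) (F ((- N n) *\<^sub>R u)))"
  have "\<exists>u F G s. Q n u F G s" for n
  proof -
    obtain s0 where s0: "density_between a b s0" "\<not> realizable (\<Lambda> - d n) L s0" using dn by blast
    have "0 \<le> a" "a \<le> b" "0 \<le> \<Lambda> - d n" using ab d[of n] by auto
    then show ?thesis
      by (rule blow_up_stretched_piece[OF _ _ _ N(2)[of n] N(1)[of n] up[where n=n] s0])
         (assumption | unfold Q_def, intro exI conjI)+
  qed
  then obtain u F G s where "\<And>n. Q n (u n) (F n) (G n) (s n)" by metis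
  then have A: "\<And>n. norm (u n) = 1" "\<And>n. lip_pair (\<Lambda> + d n) L (F n) (G n)" "\<And>n. F n 0 = 0"
     "\<And>n. density_between a b (s n)" "\<And>n. realizes (G n) (s n)"
     "\<And>n. emeasure lborel {z \<in> ball 0 (N n). s n z \<noteq> half_pattern a b (u n) z} \<le> ennreal (4 * (N n)\<^sup>2 * \<eta> n)"
     "\<And>n. 2 * N n * (\<Lambda> - d n) \<le> dist (F n (N n *\<^sub>R u n)) (F n ((- N n) *\<^sub>R u n))"
    unfolding Q_def by blast+
  have m: "s n \<in> borel_measurable borel" for n using A(4) by (simp add: density_between_def)
  have "compact (sphere (0::real^2) 1)" by simp
  then obtain u' k where k: "strict_mono k" "(u \<circ> k) \<longlonglongrightarrow> u'" "u' \<in> sphere 0 1"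
    using A(1) unfolding compact_def by (metis mem_sphere_0)
  have u': "norm u' = 1" using k(3) by simp
  then have u'0: "u' \<noteq> 0" by auto
  \<comment> \<open>Two approximations are combined: \<open>s n\<close> differs from the pattern in
    direction \<open>u n\<close> only on a small set within a large ball, and these patterns
    converge almost everywhere along \<open>k\<close>.\<close>
  have lim: "(\<lambda>n. \<integral>x. \<phi> x * s (k n) x \<partial>lborel) \<longlonglongrightarrow> (\<integral>x. \<phi> x * half_pattern a b u' x \<partial>lborel)"
    if \<phi>: "test_fun \<phi>" for \<phi>
  proof -
    have "(\<lambda>n. (\<integral>x. \<phi> x * s n x \<partial>lborel) - (\<integral>x. \<phi> x * half_pattern a b (u n) x \<partial>lborel)) \<longlonglongrightarrow> 0"
    proof (rule test_integral_diff_tendsto_0[OF \<phi> m half_pattern_measurable, where B = b and r = real and e = "\<lambda>n. 4 / N n"])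
      show "AE x in lborel. \<bar>s n x\<bar> \<le> b" "AE x in lborel. \<bar>half_pattern a b (u n) x\<bar> \<le> b" for n
        proof -
        have "\<bar>s n x\<bar> \<le> b" for x
          using A(4)[of n] ab by (simp add: density_between_def) (smt (verit))
        then show "AE x in lborel. \<bar>s n x\<bar> \<le> b" by simp
      qed (use ab in \<open>auto simp: half_pattern_def\<close>)
      show "emeasure lborel {x \<in> cball 0 (real n). s n x \<noteq> half_pattern a b (u n) x} \<le> ennreal (4 / N n)" for n
      proof -
        have "4 / N n = 4 * (N n)\<^sup>2 * \<eta> n"
          using N(1)[of n] by (simp add: \<eta>_def power2_eq_square power3_eq_cube)
        moreover have "emeasure lborel {x \<in> cball 0 (real n). s n x \<noteq> half_pattern a b (u n) x}
            \<le> emeasure lborel {x \<in> ball 0 (N n). s n x \<noteq> half_pattern a b (u n) x}"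
          using m[of n] by (intro emeasure_mono) (auto simp: N_def)
        ultimately show ?thesis using A(6)[of n] by simp
      qed
      show "(\<lambda>n. 4 / N n) \<longlonglongrightarrow> 0"
        unfolding N_def using tendsto_mult_right_zero[OF LIMSEQ_inverse_real_of_nat, of 4] by (simp add: divide_inverse)
    qed (use N ab in \<open>auto simp: less_imp_le filterlim_real_sequentially\<close>)
    then have "(\<lambda>n. (\<integral>x. \<phi> x * s (k n) x \<partial>lborel) - (\<integral>x. \<phi> x * half_pattern a b (u (k n)) x \<partial>lborel)) \<longlonglongrightarrow> 0"
      using LIMSEQ_subseq_LIMSEQ[OF _ k(1)] by (force simp: o_def)
    moreover have "(\<lambda>n. \<integral>x. \<phi> x * half_pattern a b (u (k n)) x \<partial>lborel) \<longlonglongrightarrow> (\<integral>x. \<phi> x * half_pattern a b u' x \<partial>lborel)"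
    proof (rule tendsto_test_integral_AE[OF \<phi>])
      show "AE x in lborel. (\<lambda>n. half_pattern a b (u (k n)) x) \<longlonglongrightarrow> half_pattern a b u' x"
        using tendsto_half_pattern[OF k(2) u'0, of a b] by (simp add: o_def)
      show "\<exists>B. \<forall>n. AE x in lborel. norm x \<le> R \<longrightarrow> \<bar>half_pattern a b (u (k n)) x\<bar> \<le> B" for R
        using ab by (intro exI[of _ b]) (auto simp: half_pattern_def)
    qed auto
    ultimately show ?thesis using tendsto_add by fastforce
  qed
  \<comment> \<open>Compactness asks for one constant for all \<open>n\<close>; the sharp constant
    \<open>\<Lambda>\<close> is recovered for the limit map afterwards.\<close>
  have p2: "lip_pair (2 * \<Lambda>) L (F (k n)) (G (k n))" for n
    using d(2)[of "k n"] by (intro lip_pair_mono[OF A(2)]) auto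
  obtain r F' G' where r: "strict_mono r" "lip_pair (2 * \<Lambda>) L F' G'" "\<And>x. (\<lambda>n. F (k (r n)) x) \<longlonglongrightarrow> F' x"
      "F' 0 = 0" "realizes G' (half_pattern a b u')"
    using lip_pair_compactness[OF p2 A(3) A(5) lim] by metis
  define j where "j = k \<circ> r"
  have j: "strict_mono j" unfolding j_def using k r by (intro strict_mono_o)
  have uj: "(\<lambda>n. u (j n)) \<longlonglongrightarrow> u'"
    using LIMSEQ_subseq_LIMSEQ[OF k(2) r(1)] by (simp add: j_def o_def)
  have Fj: "(\<lambda>n. F (j n) x) \<longlonglongrightarrow> F' x" for x using r(3) by (simp add: j_def)
  have "d \<longlonglongrightarrow> 0" unfolding d_def by real_asymp
  then have dj: "(\<lambda>n. d (j n)) \<longlonglongrightarrow> 0" using LIMSEQ_subseq_LIMSEQ[OF _ j] by (force simp: o_def)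
  have "(\<lambda>n. N n * d n) \<longlonglongrightarrow> 0" unfolding d_def N_def by real_asymp
  then have Ndj: "(\<lambda>n. N (j n) * d (j n)) \<longlonglongrightarrow> 0" using LIMSEQ_subseq_LIMSEQ[OF _ j] by (force simp: o_def)
  have lip: "dist (F' x) (F' y) \<le> \<Lambda> * dist x y" for x y
  proof (rule LIMSEQ_le)
    show "(\<lambda>n. dist (F (j n) x) (F (j n) y)) \<longlonglongrightarrow> dist (F' x) (F' y)" by (intro tendsto_intros Fj)
    have "(\<lambda>n. (\<Lambda> + d (j n)) * dist x y) \<longlonglongrightarrow> (\<Lambda> + 0) * dist x y" by (intro tendsto_intros dj)
    then show "(\<lambda>n. (\<Lambda> + d (j n)) * dist x y) \<longlonglongrightarrow> \<Lambda> * dist x y" by simp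
  qed (use lip_pair_D(1)[OF A(2)] in blast)
  \<comment> \<open>The two outer parts of the long segment, between \<open>t\<close> and
    \<open>N (j n)\<close> on either side, are stretched by at most
    \<open>\<Lambda> + d (j n)\<close>. This leaves \<open>2 * t * \<Lambda>\<close>, up to the
    first term of \<open>?e\<close>, for the middle part; the second term pays for replacing
    \<open>u (j n)\<close> by \<open>u'\<close>.\<close>
  have stretch: "2 * t * \<Lambda> \<le> dist (F' (t *\<^sub>R u')) (F' ((- t) *\<^sub>R u'))" if t: "0 < t" for t
  proof (rule LIMSEQ_le)
    let ?e = "\<lambda>n. 4 * (N (j n) * d (j n)) + 2 * (2 * \<Lambda> * (t * dist (u (j n)) u'))"
    show "(\<lambda>n. dist (F (j n) (t *\<^sub>R u')) (F (j n) ((- t) *\<^sub>R u'))) \<longlonglongrightarrow> dist (F' (t *\<^sub>R u')) (F' ((- t) *\<^sub>R u'))"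
      by (intro tendsto_intros Fj)
    have "?e \<longlonglongrightarrow> 4 * 0 + 2 * (2 * \<Lambda> * (t * dist u' u'))"
      by (intro tendsto_intros Ndj uj)
    then show "(\<lambda>n. 2 * t * \<Lambda> - ?e n) \<longlonglongrightarrow> 2 * t * \<Lambda>"
      using tendsto_diff[OF tendsto_const, of ?e 0 sequentially "2 * t * \<Lambda>"] by simp
    have "2 * t * \<Lambda> - ?e n \<le> dist (F (j n) (t *\<^sub>R u')) (F (j n) ((- t) *\<^sub>R u'))" if n: "t \<le> real n" for n
    proof -
      let ?f = "F (j n)" and ?u = "u (j n)" and ?N = "N (j n)" and ?d = "d (j n)"
      note D = lip_pair_D(1)[OF A(2)[of "j n"]]
      have tN: "t \<le> ?N" using n seq_suble[OF j, of n] by (simp add: N_def)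
      have 1: "dist (?f (v *\<^sub>R ?u)) (?f (w *\<^sub>R ?u)) \<le> (\<Lambda> + ?d) * \<bar>v - w\<bar>" for v w
        using D[of "v *\<^sub>R ?u" "w *\<^sub>R ?u"] A(1)[of "j n"] by (simp add: dist_norm scaleR_diff_left[symmetric])
      have 2: "dist (?f (v *\<^sub>R ?u)) (?f (v *\<^sub>R u')) \<le> 2 * \<Lambda> * (t * dist ?u u')" if "\<bar>v\<bar> = t" for v
      proof -
        have "dist (v *\<^sub>R ?u) (v *\<^sub>R u') = t * dist ?u u'"
          using that by (simp add: dist_norm scaleR_diff_right[symmetric])
        then have "dist (?f (v *\<^sub>R ?u)) (?f (v *\<^sub>R u')) \<le> (\<Lambda> + ?d) * (t * dist ?u u')"
          using D[of "v *\<^sub>R ?u" "v *\<^sub>R u'"] by simp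
        also have "\<dots> \<le> 2 * \<Lambda> * (t * dist ?u u')"
          using d(2)[of "j n"] t by (intro mult_right_mono) auto
        finally show ?thesis .
      qed
      have 3: "dist (?f (?N *\<^sub>R ?u)) (?f (t *\<^sub>R ?u)) \<le> (\<Lambda> + ?d) * (?N - t)"
              "dist (?f ((- ?N) *\<^sub>R ?u)) (?f ((- t) *\<^sub>R ?u)) \<le> (\<Lambda> + ?d) * (?N - t)"
        using 1[of ?N t] 1[of "- ?N" "- t"] tN by (auto simp: abs_if split: if_splits)
      have 4: "dist (?f (?N *\<^sub>R ?u)) (?f ((- ?N) *\<^sub>R ?u))
          \<le> dist (?f (?N *\<^sub>R ?u)) (?f (t *\<^sub>R ?u)) + dist (?f (t *\<^sub>R ?u)) (?f (t *\<^sub>R u'))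
           + dist (?f (t *\<^sub>R u')) (?f ((- t) *\<^sub>R u'))
           + dist (?f ((- t) *\<^sub>R ?u)) (?f ((- t) *\<^sub>R u')) + dist (?f ((- ?N) *\<^sub>R ?u)) (?f ((- t) *\<^sub>R ?u))"
        using dist_triangle[of "?f (?N *\<^sub>R ?u)" "?f ((- ?N) *\<^sub>R ?u)" "?f (t *\<^sub>R ?u)"]
          dist_triangle[of "?f (t *\<^sub>R ?u)" "?f ((- ?N) *\<^sub>R ?u)" "?f (t *\<^sub>R u')"]
          dist_triangle[of "?f (t *\<^sub>R u')" "?f ((- ?N) *\<^sub>R ?u)" "?f ((- t) *\<^sub>R u')"]
          dist_triangle3[of "?f ((- t) *\<^sub>R u')" "?f ((- ?N) *\<^sub>R ?u)" "?f ((- t) *\<^sub>R ?u)"]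
          dist_commute[of "?f ((- t) *\<^sub>R ?u)" "?f ((- ?N) *\<^sub>R ?u)"]
        by linarith
      have 5: "(\<Lambda> + ?d) * (?N - t) \<le> \<Lambda> * ?N - \<Lambda> * t + ?N * ?d"
        using d(1)[of "j n"] t by (simp add: algebra_simps)
      have 6: "2 * ?N * (\<Lambda> - ?d) = 2 * (\<Lambda> * ?N) - 2 * (?N * ?d)" "2 * t * \<Lambda> = 2 * (\<Lambda> * t)"
        by (simp_all add: algebra_simps)
      have arith: "2 * X - (4 * e + 2 * w) \<le> z"
        if "a1 \<le> w" "a2 \<le> w" "b1 \<le> c" "b2 \<le> c" "tot \<le> b1 + a1 + z + a2 + b2" "c \<le> Y - X + e"
          "2 * Y - 2 * e \<le> tot"
        for X Y a1 a2 b1 b2 c e tot w z :: real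
        using that by linarith
      show ?thesis
        unfolding 6
        by (rule arith[OF 2 2 3 4 5 A(7)[of "j n", unfolded 6]]) (use t in simp_all)
    qed
    moreover obtain M :: nat where "t \<le> real M" using real_arch_simple by blast
    ultimately show "\<exists>M. \<forall>n\<ge>M. 2 * t * \<Lambda> - ?e n \<le> dist (F (j n) (t *\<^sub>R u')) (F (j n) ((- t) *\<^sub>R u'))"
      by (intro exI[of _ M] allI impI) simp
  qed
  have "lip_pair \<Lambda> L F' G'"
    using lip lip_pair_D[OF r(2)] \<Lambda> by (intro lip_pairI) auto
  from half_pattern_not_realized_if_stretches_line[OF this r(4) u' stretch r(5)]
  show False using ab by simp
qed

section \<open>From Jacobians to realizable densities\<close>

text \<open>A natural number as common constant makes a countable union possible at the end.\<close>

lemma bi_lipschitz_homeo_lip_pair: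
  assumes "bi_lipschitz_homeo f"
  obtains n :: nat and g where "lip_pair (real n) (real n) f g"
proof -
  obtain L g where L: "1 \<le> L" "bi_lipschitz_const L f" and g: "homeomorphism UNIV UNIV f g"
    using assms by (auto simp: bi_lipschitz_homeo_def bi_lipschitz_def)
  have inv: "g (f x) = x" "f (g x) = x" for x using g by (auto simp: homeomorphism_def)
  have b: "dist (f x) (f y) \<le> L * dist x y" "dist x y \<le> L * dist (f x) (f y)" for x y
    using L unfolding bi_lipschitz_const_def by (auto simp: divide_le_eq mult.commute)
  obtain n :: nat where n: "L \<le> real n" using real_arch_simple by blast
  have "lip_pair L L f g"
    using b b(2)[of "g _" "g _"] inv L by (intro lip_pairI) auto
  then show ?thesis using that lip_pair_mono n by blast
qed

text \<open>The vector-valued change of variables, applied to functions into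
  \<open>real ^ 1\<close>.\<close>

lemma has_absolute_integral_change_of_variables_scalar:
  fixes f :: "real^'m::{finite,wellorder} \<Rightarrow> real" and g :: "real^'m::_ \<Rightarrow> real^'m::_"
  assumes "S \<in> sets lebesgue" "\<And>x. x \<in> S \<Longrightarrow> (g has_derivative g' x) (at x within S)" "inj_on g S"
  shows "(\<lambda>x. \<bar>det (matrix (g' x))\<bar> * f (g x)) absolutely_integrable_on S \<and>
           integral S (\<lambda>x. \<bar>det (matrix (g' x))\<bar> * f (g x)) = b
     \<longleftrightarrow> f absolutely_integrable_on (g ` S) \<and> integral (g ` S) f = b"
proof -
  have "(\<lambda>x. \<bar>det (matrix (g' x))\<bar> *\<^sub>R vec (f (g x)) :: real ^ 1) absolutely_integrable_on S \<and>
           integral S (\<lambda>x. \<bar>det (matrix (g' x))\<bar> *\<^sub>R vec (f (g x))) = (vec b :: real ^ 1)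
         \<longleftrightarrow> (\<lambda>x. vec (f x) :: real ^ 1) absolutely_integrable_on (g ` S) \<and>
           integral (g ` S) (\<lambda>x. vec (f x)) = (vec b :: real ^ 1)"
    using assms by (intro has_absolute_integral_change_of_variables) auto
  then show ?thesis
    by (simp add: absolutely_integrable_on_1_iff integral_on_1_eq)
qed

text \<open>This is the change of variables for \<open>\<phi>\<close> composed with
  \<open>g\<close>, on the set \<open>S\<close> of full measure where the derivative exists and has
  determinant \<open>s\<close>. Positivity removes the absolute value of the determinant.\<close>

lemma realizable_if_Jac_eq_AE:
  assumes f: "bi_lipschitz_homeo f" and J: "Jac_eq_AE f \<rho>" and pos: "AE x in lebesgue. 0 < \<rho> x"
    and [measurable]: "s \<in> borel_measurable borel" and s: "AE x in lebesgue. \<rho> x = s x"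
  shows "\<exists>n::nat. realizable (real n) (real n) s"
proof -
  obtain n g where p: "lip_pair (real n) (real n) f g" using bi_lipschitz_homeo_lip_pair[OF f] .
  note D = lip_pair_D[OF p]
  have "AE x in lebesgue. f differentiable (at x) \<and> Jac f x = s x \<and> 0 < s x"
    using J[unfolded Jac_eq_AE_def] pos s by eventually_elim auto
  then obtain N where N: "N \<in> null_sets lebesgue" "{x. \<not> (f differentiable (at x) \<and> Jac f x = s x \<and> 0 < s x)} \<subseteq> N"
    unfolding eventually_ae_filter by auto
  define S where "S = - N"
  have S: "f differentiable (at x)" "\<bar>det (matrix (frechet_derivative f (at x)))\<bar> = s x" if "x \<in> S" for x
  proof -
    have "f differentiable (at x) \<and> Jac f x = s x \<and> 0 < s x" using N(2) that unfolding S_def by blast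
    then show "f differentiable (at x)" "\<bar>det (matrix (frechet_derivative f (at x)))\<bar> = s x"
      by (simp_all add: Jac_def)
  qed
  have SL: "S \<in> sets lebesgue"
    using N(1) unfolding S_def by (subst Compl_in_sets_lebesgue) (rule null_setsD2)
  have nS: "negligible (UNIV - S)" using N(1) by (simp add: S_def negligible_iff_null_sets Diff_eq)
  \<comment> \<open>A Lipschitz map sends null sets to null sets, so the image of \<open>S\<close>
    has full measure as well.\<close>
  have "negligible (f ` N)"
  proof (rule negligible_locally_Lipschitz_image)
    show "negligible N" using N(1) by (simp add: negligible_iff_null_sets)
    show "\<exists>T B. open T \<and> x \<in> T \<and> (\<forall>y\<in>N \<inter> T. norm (f y - f x) \<le> B * norm (y - x))" for x
      using D(1) by (intro exI[of _ UNIV] exI[of _ "real n"]) (auto simp: dist_norm)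
  qed simp
  moreover have "UNIV - f ` S \<subseteq> f ` N"
  proof
    fix y assume "y \<in> UNIV - f ` S"
    then have "g y \<notin> S" using D(4)[of y] by (metis Diff_iff imageI)
    then show "y \<in> f ` N" using D(4)[of y] by (metis ComplI S_def imageI)
  qed
  ultimately have nfS: "negligible (UNIV - f ` S)" using negligible_subset by blast
  have der: "(f has_derivative frechet_derivative f (at x)) (at x within S)" if "x \<in> S" for x
    using S(1)[OF that] by (simp add: frechet_derivative_works has_derivative_at_withinI)
  have inj: "inj_on f S" using D(3) by (metis inj_on_inverseI)
  have "realizes g s"
    unfolding realizes_def
  proof (intro allI impI)
    fix \<phi> :: "real^2 \<Rightarrow> real" assume \<phi>: "test_fun \<phi>"
    note [measurable] = test_fun_borel[OF \<phi>]
    have [measurable]: "g \<in> borel_measurable borel" using D(8) by (rule borel_measurable_continuous_onI)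
    obtain B R where BR: "0 < B" "0 < R" "\<And>x. \<bar>\<phi> x\<bar> \<le> B" "\<And>x. R < norm x \<Longrightarrow> \<phi> x = 0"
      using test_fun_bounded[OF \<phi>] by metis
    have ih: "integrable lborel (\<lambda>y. \<phi> (g y))"
    proof (rule integrable_bounded_support[where B = B and R = "norm (f 0) + real n * R"])
      fix y :: "real^2" assume y: "norm (f 0) + real n * R < norm y"
      show "\<phi> (g y) = 0"
      proof (rule BR(4), rule ccontr)
        assume "\<not> R < norm (g y)"
        then have "real n * norm (g y) \<le> real n * R" by (intro mult_left_mono) auto
        moreover have "norm y \<le> norm (f 0) + real n * norm (g y)"
          using D(1)[of "g y" 0] D(4)[of y] norm_triangle_ineq2[of y "f 0"] by (simp add: dist_norm)
        ultimately show False using y by simp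
      qed
    qed (use BR in auto)
    have iU: "integrable lebesgue (\<lambda>y. \<phi> (g y))" using ih by (subst integrable_completion) auto
    have aU: "(\<lambda>y. \<phi> (g y)) absolutely_integrable_on (f ` S)"
    proof (rule set_integrable_subset)
      show "set_integrable lebesgue UNIV (\<lambda>y. \<phi> (g y))" using iU by (simp add: set_integrable_def)
      have "f ` S = UNIV - (UNIV - f ` S)" by auto
      also have "\<dots> \<in> sets lebesgue"
        by (rule sets.Diff[OF _ negligible_imp_sets[OF nfS]]) simp
      finally show "f ` S \<in> sets lebesgue" .
    qed auto
    have vU: "integral (f ` S) (\<lambda>y. \<phi> (g y)) = (\<integral>y. \<phi> (g y) \<partial>lborel)"
      using integral_subset_negligible[of "f ` S" UNIV "\<lambda>y. \<phi> (g y)"] nfS integral_lborel[OF ih] by simp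
    let ?F = "\<lambda>x. \<bar>det (matrix (frechet_derivative f (at x)))\<bar> * \<phi> (g (f x))"
    have F: "?F absolutely_integrable_on S" "integral S ?F = (\<integral>y. \<phi> (g y) \<partial>lborel)"
      using has_absolute_integral_change_of_variables_scalar[OF SL der inj, of "\<lambda>y. \<phi> (g y)"] aU vU by auto
    have eq: "?F x = \<phi> x * s x" if "x \<in> S" for x using S(2)[OF that] D(3) by simp
    have aS: "(\<lambda>x. \<phi> x * s x) absolutely_integrable_on S"
      using F(1) eq by (subst set_integrable_cong[of _ lebesgue _ S _ ?F]) auto
    have "integrable lebesgue (\<lambda>x. \<phi> x * s x) \<longleftrightarrow> integrable lebesgue (\<lambda>x. indicat_real S x *\<^sub>R (\<phi> x * s x))"
    proof (rule integrable_cong_AE)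
      show "(\<lambda>x. \<phi> x * s x) \<in> borel_measurable lebesgue" by (intro measurable_completion) measurable
      show "(\<lambda>x. indicat_real S x *\<^sub>R (\<phi> x * s x)) \<in> borel_measurable lebesgue"
        using aS unfolding set_integrable_def by (rule borel_measurable_integrable)
      show "AE x in lebesgue. \<phi> x * s x = indicat_real S x *\<^sub>R (\<phi> x * s x)"
        by (rule AE_I'[OF N(1)]) (auto simp: S_def indicator_def)
    qed
    then have "integrable lebesgue (\<lambda>x. \<phi> x * s x)" using aS by (simp add: set_integrable_def)
    then have i: "integrable lborel (\<lambda>x. \<phi> x * s x)" by (subst (asm) integrable_completion) auto
    have "(\<integral>x. \<phi> x * s x \<partial>lborel) = integral UNIV (\<lambda>x. \<phi> x * s x)" using integral_lborel[OF i] by simp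
    also have "\<dots> = integral S (\<lambda>x. \<phi> x * s x)"
      by (rule integral_subset_negligible[OF subset_UNIV nS, symmetric])
    also have "\<dots> = integral S ?F" using eq by (intro Henstock_Kurzweil_Integration.integral_cong) simp
    finally show "(\<integral>y. \<phi> (g y) \<partial>lborel) = (\<integral>x. \<phi> x * s x \<partial>lborel)" using F(2) by simp
  qed
  then show ?thesis using p by (auto simp: realizable_def)
qed

section \<open>Nowhere dense sets of realizable densities\<close>

text \<open>The assumption \<open>nd\<close> is nowhere density in metric form. The points at
  positive distance from \<open>A n\<close> form an open set by the triangle inequality, and
  \<open>nd\<close> makes it dense.\<close>

lemma thick_if_complement_meager:
  assumes G: "G \<subseteq> mspace m" "mspace m - G \<subseteq> (\<Union>n::nat. A n)"
    and nd: "\<And>n x e. x \<in> mspace m \<Longrightarrow> 0 < e \<Longrightarrow>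
      \<exists>y\<in>mspace m. mdist m x y < e \<and> (\<exists>d>0. \<forall>z\<in>A n \<inter> mspace m. d \<le> mdist m y z)"
  shows "thick m G"
proof -
  interpret Metric_space "mspace m" "mdist m" by (rule Metric_space_mspace_mdist)
  define U where "U = (\<lambda>n. {y\<in>mspace m. \<exists>d>0. \<forall>z\<in>A n \<inter> mspace m. d \<le> mdist m y z})"
  have "openin mtopology (U n)" for n
    unfolding openin_mtopology
  proof (intro conjI allI impI)
    fix y assume "y \<in> U n"
    then obtain d where d: "y \<in> mspace m" "0 < d" "\<And>z. z \<in> A n \<inter> mspace m \<Longrightarrow> d \<le> mdist m y z"
      by (auto simp: U_def)
    show "\<exists>r>0. mball y r \<subseteq> U n"
    proof (intro exI[of _ "d / 2"] conjI subsetI)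
      fix y' assume "y' \<in> mball y (d / 2)"
      then have y': "y' \<in> mspace m" "mdist m y y' < d / 2" by auto
      have "d / 2 \<le> mdist m y' z" if "z \<in> A n \<inter> mspace m" for z
        using d(3)[OF that] triangle[of y y' z] y' d(1) that by auto
      then show "y' \<in> U n" using y' d(2) unfolding U_def by (auto intro!: exI[of _ "d / 2"])
    qed (use d in auto)
  qed (auto simp: U_def)
  moreover have "mtopology closure_of U n = mspace m" for n
    using nd[where n = n] unfolding metric_closure_of by (force simp: U_def)
  moreover have "(\<Inter>n. U n) \<subseteq> G"
  proof
    fix x assume x: "x \<in> (\<Inter>n. U n)"
    show "x \<in> G"
    proof (rule ccontr)
      assume "x \<notin> G"
      moreover have "x \<in> mspace m" using x by (auto simp: U_def)
      ultimately obtain n where "x \<in> A n" using G(2) by blast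
      moreover have "x \<in> U n" using x by blast
      ultimately obtain d where "0 < d" "d \<le> mdist m x x"
        using \<open>x \<in> mspace m\<close> unfolding U_def by blast
      then show False using mdist_zero \<open>x \<in> mspace m\<close> by auto
    qed
  qed
  ultimately show ?thesis using G(1) unfolding thick_def mtopology_of_def by blast
qed

text \<open>Approximants within \<open>1 / real (Suc n)\<close> converge almost everywhere with
  local bounds, so compactness applies. Hence realizable densities that are dense in a ball fill
  it.\<close>

lemma realizable_uniform_limit:
  assumes [measurable]: "s \<in> borel_measurable borel"
    and bd: "\<And>R. \<exists>B. AE x in lborel. norm x \<le> R \<longrightarrow> \<bar>s x\<bar> \<le> B"
    and ap: "\<And>d. 0 < d \<Longrightarrow> \<exists>t. t \<in> borel_measurable borel \<and> realizable K L t \<and> (AE x in lborel. \<bar>t x - s x\<bar> \<le> d)"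
  shows "realizable K L s"
proof -
  have "\<exists>t. t \<in> borel_measurable borel \<and> realizable K L t \<and> (AE x in lborel. \<bar>t x - s x\<bar> \<le> 1 / real (Suc n))" for n
    by (rule ap) simp
  then obtain t where t: "\<And>n. t n \<in> borel_measurable borel" "\<And>n. realizable K L (t n)"
      "\<And>n. AE x in lborel. \<bar>t n x - s x\<bar> \<le> 1 / real (Suc n)"
    by metis
  show ?thesis
  proof (rule realizable_limit[OF t(2,1)])
    fix \<phi> :: "real^2 \<Rightarrow> real" assume \<phi>: "test_fun \<phi>"
    show "(\<lambda>n. \<integral>x. \<phi> x * t n x \<partial>lborel) \<longlonglongrightarrow> (\<integral>x. \<phi> x * s x \<partial>lborel)"
    proof (rule tendsto_test_integral_AE[OF \<phi> t(1)])
      show "\<exists>B. \<forall>n. AE x in lborel. norm x \<le> R \<longrightarrow> \<bar>t n x\<bar> \<le> B" for R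
      proof -
        obtain B where B: "AE x in lborel. norm x \<le> R \<longrightarrow> \<bar>s x\<bar> \<le> B" using bd by blast
        have "AE x in lborel. norm x \<le> R \<longrightarrow> \<bar>t n x\<bar> \<le> B + 1" for n
          using B t(3)[of n]
        proof eventually_elim
          case (elim x)
          moreover have "1 / real (Suc n) \<le> 1" by simp
          ultimately show ?case by linarith
        qed
        then show ?thesis by blast
      qed
      have "AE x in lborel. \<forall>n. \<bar>t n x - s x\<bar> \<le> 1 / real (Suc n)" using t(3) by (simp add: AE_all_countable)
      then show "AE x in lborel. (\<lambda>n. t n x) \<longlonglongrightarrow> s x"
      proof eventually_elim
        case (elim x)
        have "(\<lambda>n. t n x - s x) \<longlonglongrightarrow> 0"
          by (rule Lim_null_comparison[OF _ LIMSEQ_inverse_real_of_nat]) (use elim in \<open>auto simp: inverse_eq_divide\<close>)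
        then show ?case by (simp add: LIM_zero_iff)
      qed
    qed simp
  qed
qed

section \<open>Zooming in on a set of positive measure\<close>

text \<open>A form of the Lebesgue density theorem. A bounded part of \<open>E\<close> is covered by
  dyadic cubes inside an open set \<open>U\<close> of only slightly larger measure. If each cube had
  a fraction \<open>\<eta>\<close> of its area outside \<open>E\<close>, these areas would add up to
  more than \<open>U\<close> has to spare. So \<open>E\<close> almost fills one cube, and a ball
  inside that cube is blown up.\<close>

lemma blow_up_to_full_density:
  fixes E :: "(real^2) set"
  assumes [measurable]: "E \<in> sets borel" and E: "emeasure lborel E \<noteq> 0" and k: "0 < k" and \<epsilon>: "0 < \<epsilon>"
  obtains m c where "0 < c" "emeasure lborel {x \<in> cball 0 k. m + c *\<^sub>R x \<notin> E} \<le> ennreal \<epsilon>"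
proof -
  define Q where "Q = (\<lambda>n::nat. cbox (- (real n *\<^sub>R One)) (real n *\<^sub>R One) :: (real^2) set)"
  have "\<exists>n. emeasure lborel (E \<inter> Q n) \<noteq> 0"
  proof (rule ccontr)
    assume "\<not> ?thesis"
    then have "emeasure lborel (\<Union>n. E \<inter> Q n) = 0"
      by (intro emeasure_UN_eq_0) (auto simp: Q_def)
    moreover have "(\<Union>n. E \<inter> Q n) = E"
    proof -
      have "\<exists>n. x \<in> Q n" for x
      proof -
        obtain n :: nat where "norm x \<le> real n" using real_arch_simple by blast
        then have "x \<in> Q n" using Basis_le_norm[of _ x] unfolding Q_def mem_box by (force simp: abs_le_iff)
        then show ?thesis ..
      qed
      then show ?thesis by blast
    qed
    ultimately show False using E by simp
  qed
  then obtain n where n: "emeasure lborel (E \<inter> Q n) \<noteq> 0" by blast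
  define E0 where "E0 = E \<inter> Q n"
  have [measurable]: "E0 \<in> sets borel" by (auto simp: E0_def Q_def)
  have n0: "0 < n"
  proof (rule ccontr)
    assume "\<not> ?thesis"
    then have "Q n = {0}" by (simp add: Q_def)
    then have "emeasure lborel (E \<inter> Q n) \<le> emeasure lborel {0::real^2}" by (intro emeasure_mono) auto
    then show False using n by simp
  qed
  \<comment> \<open>The cube found below has side \<open>2 * h\<close>, and the ball of radius
    \<open>k\<close> is put into it with the factor \<open>c = h / (2 * k)\<close>; the choice gives
    \<open>\<eta> * (2 * h)\<^sup>2 = c\<^sup>2 * \<epsilon>\<close>.\<close>
  define \<eta> where "\<eta> = \<epsilon> / (16 * k\<^sup>2)"
  have \<eta>: "0 < \<eta>" using k \<epsilon> by (simp add: \<eta>_def)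
  have fin: "emeasure lborel E0 < \<infinity>"
    by (rule emeasure_bounded_finite) (auto simp: E0_def Q_def intro: bounded_subset[OF bounded_cbox])
  define \<mu> where "\<mu> = measure lborel E0"
  have \<mu>: "emeasure lborel E0 = ennreal \<mu>" using fin by (simp add: \<mu>_def emeasure_eq_ennreal_measure)
  have \<mu>0: "0 < \<mu>" using n \<mu> by (auto simp: E0_def[symmetric] \<mu>_def zero_less_measure_iff)
  obtain U where U: "open U" "E0 \<subseteq> U" "emeasure lebesgue (U - E0) < ennreal (\<eta> * \<mu>)"
    using sets_lebesgue_outer_open[of E0 "\<eta> * \<mu>"] \<eta> \<mu>0 by auto
  have "\<forall>x\<in>E0. \<exists>r>0. ball x r \<subseteq> U" using U(1,2) open_contains_ball by blast
  then obtain r where r: "\<And>x. x \<in> E0 \<Longrightarrow> 0 < r x \<and> ball x (r x) \<subseteq> U" by metis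
  \<comment> \<open>Every cube of the covering lies in \<open>\<gamma> x\<close> for some
    \<open>x\<close> in \<open>E0\<close>, so this gauge keeps all cubes inside
    \<open>U\<close>.\<close>
  define \<gamma> where "\<gamma> = (\<lambda>x. if x \<in> E0 then ball x (r x) else ball x 1)"
  have g: "gauge \<gamma>" using r by (auto simp: \<gamma>_def gauge_def)
  have ne: "box (- (real n *\<^sub>R One)) (real n *\<^sub>R One :: real^2) \<noteq> {}" using n0 by (simp add: box_ne_empty inner_simps)
  obtain \<D> where \<D>: "countable \<D>" 
    "\<And>K. K \<in> \<D> \<Longrightarrow> interior K \<noteq> {} \<and> (\<exists>c d. K = cbox c d)"
    "pairwise (\<lambda>A B. interior A \<inter> interior B = {}) \<D>"
    "\<And>K. K \<in> \<D> \<Longrightarrow> \<exists>x \<in> E0 \<inter> K. K \<subseteq> \<gamma> x"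
    "\<And>u v. cbox u v \<in> \<D> \<Longrightarrow> \<exists>N. \<forall>i \<in> Basis. v \<bullet> i - u \<bullet> i = (real n *\<^sub>R One \<bullet> i - (- (real n *\<^sub>R One)) \<bullet> i) / 2^N"
    "E0 \<subseteq> \<Union>\<D>"
    by (rule covering_lemma[OF _ ne g, of E0]) (auto simp: E0_def Q_def)
  have KU: "K \<subseteq> U" if "K \<in> \<D>" for K using \<D>(4)[OF that] r by (force simp: \<gamma>_def)
  have "\<exists>K\<in>\<D>. emeasure lborel (interior K - E) \<le> ennreal \<eta> * emeasure lborel (interior K)"
  proof (rule ccontr)
    assume "\<not> ?thesis"
    then have big: "\<And>K. K \<in> \<D> \<Longrightarrow> ennreal \<eta> * emeasure lborel (interior K) \<le> emeasure lborel (interior K - E)"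
      by (meson linear)
    define V where "V = (\<Union>K\<in>\<D>. interior K)"
    have [measurable]: "V \<in> sets borel" using \<D>(1) by (auto simp: V_def)
    have disj: "disjoint_family_on (\<lambda>K. interior K) \<D>" "disjoint_family_on (\<lambda>K. interior K - E) \<D>"
      using \<D>(3) by (auto simp: disjoint_family_on_def pairwise_def)
    \<comment> \<open>The interiors of the cubes are disjoint and the boundaries are null, so
      \<open>V\<close> carries all of \<open>E0\<close> up to a null set and measures can be added
      over the cubes.\<close>
    have "ennreal \<eta> * ennreal \<mu> \<le> ennreal \<eta> * emeasure lborel V"
    proof (rule mult_left_mono)
      have "E0 \<subseteq> V \<union> (\<Union>K\<in>\<D>. K - interior K)" using \<D>(6) by (auto simp: V_def)
      moreover have "(\<Union>K\<in>\<D>. K - interior K) \<in> null_sets lborel"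
      proof (rule null_sets_UN'[OF \<D>(1)])
        fix K assume "K \<in> \<D>"
        then obtain c d where K: "K = cbox c d" using \<D>(2) by blast
        have "negligible (cbox c d - box c d)" by (rule negligible_frontier_interval)
        then have "cbox c d - box c d \<in> null_sets lebesgue" by (simp add: negligible_iff_null_sets)
        then show "K - interior K \<in> null_sets lborel"
          unfolding K interior_cbox by (subst (asm) null_sets_completion_iff) auto
      qed
      ultimately have "emeasure lborel E0 \<le> emeasure lborel (V \<union> (\<Union>K\<in>\<D>. K - interior K))"
        by (intro emeasure_mono) (auto dest: null_setsD2)
      also have "\<dots> = emeasure lborel V"
        using \<open>(\<Union>K\<in>\<D>. K - interior K) \<in> null_sets lborel\<close> by (intro emeasure_Un_null_set) auto
      finally show "ennreal \<mu> \<le> emeasure lborel V" by (simp add: \<mu>)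
    qed simp
    also have "emeasure lborel V = (\<integral>\<^sup>+K. emeasure lborel (interior K) \<partial>count_space \<D>)"
      unfolding V_def by (rule emeasure_UN_countable[OF _ \<D>(1) disj(1)]) auto
    also have "ennreal \<eta> * \<dots> = (\<integral>\<^sup>+K. ennreal \<eta> * emeasure lborel (interior K) \<partial>count_space \<D>)"
      by (subst nn_integral_cmult) auto
    also have "\<dots> \<le> (\<integral>\<^sup>+K. emeasure lborel (interior K - E) \<partial>count_space \<D>)"
      using big by (intro nn_integral_mono) auto
    also have "\<dots> = emeasure lborel (\<Union>K\<in>\<D>. interior K - E)"
      by (rule emeasure_UN_countable[OF _ \<D>(1) disj(2), symmetric]) auto
    also have "\<dots> \<le> emeasure lborel (U - E0)"
    proof (rule emeasure_mono)
      show "(\<Union>K\<in>\<D>. interior K - E) \<subseteq> U - E0" using KU interior_subset by (fastforce simp: E0_def)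
      show "U - E0 \<in> sets lborel" using U(1) by (simp add: borel_open sets.Diff)
    qed
    also have "\<dots> < ennreal (\<eta> * \<mu>)" using U by (simp add: borel_open)
    finally show False using \<eta> \<mu>0 by (simp add: ennreal_mult)
  qed
  then obtain K where K: "K \<in> \<D>" "emeasure lborel (interior K - E) \<le> ennreal \<eta> * emeasure lborel (interior K)" by blast
  obtain u v where uv: "K = cbox u v" "interior K \<noteq> {}" using \<D>(2)[OF K(1)] by blast
  obtain N where N: "\<And>i. i \<in> Basis \<Longrightarrow> v \<bullet> i - u \<bullet> i = 2 * real n / 2 ^ N"
    using \<D>(5)[of u v] K(1) uv by (auto simp: inner_simps)
  define h where "h = real n / 2 ^ N"
  have h: "0 < h" using n0 by (simp add: h_def)
  have vu: "v \<bullet> i - u \<bullet> i = 2 * h" if "i \<in> Basis" for i using N[OF that] by (simp add: h_def)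
  have iK: "interior K = box u v" by (simp add: uv)
  have eK: "emeasure lborel (interior K) = ennreal ((2 * h)\<^sup>2)"
  proof -
    have "emeasure lborel (box u v) = ennreal (\<Prod>b\<in>Basis. (v - u) \<bullet> b)"
      using vu h by (intro emeasure_lborel_box) (smt (verit))
    also have "(\<Prod>b\<in>Basis. (v - u) \<bullet> b) = (\<Prod>b\<in>(Basis::(real^2) set). 2 * h)"
      by (intro prod.cong refl) (simp add: inner_diff_left vu)
    finally show ?thesis by (simp add: iK)
  qed
  define m where "m = (1/2) *\<^sub>R (u + v)"
  define c where "c = h / (2 * k)"
  have c: "0 < c" using h k by (simp add: c_def)
  have inK: "m + c *\<^sub>R x \<in> interior K" if "norm x \<le> k" for x
  proof -
    have "u \<bullet> i < (m + c *\<^sub>R x) \<bullet> i \<and> (m + c *\<^sub>R x) \<bullet> i < v \<bullet> i" if i: "i \<in> Basis" for i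
    proof -
      have "\<bar>c * (x \<bullet> i)\<bar> \<le> c * k"
        using Basis_le_norm[OF i, of x] \<open>norm x \<le> k\<close> c by (simp add: abs_mult)
      also have "\<dots> < h" using h k by (simp add: c_def)
      finally have "c * (x \<bullet> i) < h" "- h < c * (x \<bullet> i)" by (simp_all add: abs_less_iff)
      moreover have "v \<bullet> i = u \<bullet> i + 2 * h" using vu[OF i] by simp
      moreover from this have "(m + c *\<^sub>R x) \<bullet> i = u \<bullet> i + h + c * (x \<bullet> i)"
        by (simp add: m_def inner_add_left add_divide_distrib)
      ultimately show ?thesis by simp
    qed
    then show ?thesis by (simp add: iK mem_box)
  qed
  show ?thesis
  proof (rule that[OF c])
    have "ennreal (c\<^sup>2) * emeasure lborel {x \<in> cball 0 k. m + c *\<^sub>R x \<notin> E}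
        \<le> ennreal (c\<^sup>2) * emeasure lborel {x. m + c *\<^sub>R x \<in> interior K - E}"
    proof (intro mult_left_mono emeasure_mono)
      have [measurable]: "interior K \<in> sets borel" by simp
      have "{x \<in> space borel. m + c *\<^sub>R x \<in> interior K - E} \<in> sets borel" by measurable
      then show "{x. m + c *\<^sub>R x \<in> interior K - E} \<in> sets lborel" by simp
    qed (use inK in auto)
    also have "\<dots> = emeasure lborel (interior K - E)"
      using lborel_emeasure_affine[of "interior K - E" c m] c by simp
    also have "\<dots> \<le> ennreal (\<eta> * (2 * h)\<^sup>2)" using K(2) \<eta> by (simp add: eK ennreal_mult)
    also have "\<eta> * (2 * h)\<^sup>2 = c\<^sup>2 * \<epsilon>"
      using k by (simp add: \<eta>_def c_def power2_eq_square)
    also have "ennreal \<dots> = ennreal (c\<^sup>2) * ennreal \<epsilon>" by (simp add: ennreal_mult')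
    finally show "emeasure lborel {x \<in> cball 0 k. m + c *\<^sub>R x \<notin> E} \<le> ennreal \<epsilon>"
      using c by (subst (asm) ennreal_mult_le_mult_iff) auto
  qed
qed

subsection \<open>Continuous densities\<close>

lemma Cplus_dist_le:
  assumes "\<And>x. \<bar>\<rho> x - \<sigma> x\<bar> \<le> d"
  shows "Cplus_dist \<rho> \<sigma> \<le> d"
proof -
  have "ereal (Cplus_dist \<rho> \<sigma>) \<le> (SUP x. ereal \<bar>\<rho> x - \<sigma> x\<bar>)" by (simp add: ereal_Cplus_dist)
  also have "\<dots> \<le> ereal d" using assms by (intro SUP_least) simp
  finally show ?thesis by simp
qed

text \<open>Below 1 the truncation in the metric is inactive.\<close>

lemma abs_diff_le_if_Cplus_dist_less:
  assumes "Cplus_dist \<rho> \<sigma> < d" "d \<le> 1"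
  shows "\<bar>\<rho> x - \<sigma> x\<bar> \<le> d"
proof -
  have "min 1 (SUP x. ereal \<bar>\<rho> x - \<sigma> x\<bar>) < ereal d"
    using assms(1) by (simp flip: ereal_Cplus_dist)
  moreover have "ereal d \<le> 1" using assms(2) by (simp add: one_ereal_def)
  ultimately have "(SUP x. ereal \<bar>\<rho> x - \<sigma> x\<bar>) < ereal d" by (auto simp: min_def split: if_splits)
  moreover have "ereal \<bar>\<rho> x - \<sigma> x\<bar> \<le> (SUP x. ereal \<bar>\<rho> x - \<sigma> x\<bar>)" by (rule SUP_upper) simp
  ultimately have "ereal \<bar>\<rho> x - \<sigma> x\<bar> < ereal d" by (rule le_less_trans[rotated])
  then show ?thesis by simp
qed

text \<open>A Lebesgue measurable function is a limit of continuous functions off a negligible set,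
  and clamping these to the interval from \<open>a\<close> to \<open>b\<close> does not affect the
  limit.\<close>

lemma continuous_approximation:
  assumes s: "density_between a b s" and ab: "a \<le> b"
  obtains t where "\<forall>n::nat. continuous_on UNIV (t n) \<and> density_between a b (t n)"
    "AE x in lborel. (\<lambda>n. t n x) \<longlonglongrightarrow> s x"
proof -
  have [measurable]: "s \<in> borel_measurable borel" using s by (simp add: density_between_def)
  have "s \<in> borel_measurable lebesgue" by (intro measurable_completion) measurable
  then have "s measurable_on UNIV"
    by (intro lebesgue_measurable_imp_measurable_on) auto
  then obtain N g where g: "negligible N" "\<And>n. continuous_on UNIV (g n)" "\<And>x. x \<notin> N \<Longrightarrow> (\<lambda>n::nat. g n x) \<longlonglongrightarrow> s x"
    unfolding measurable_on_def by auto
  define t where "t = (\<lambda>n x. max a (min b (g n x)))"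
  show ?thesis
  proof
    have c: "continuous_on UNIV (t n)" for n unfolding t_def by (intro continuous_intros g)
    moreover have "density_between a b (t n)" for n
      using ab borel_measurable_continuous_onI[OF c[of n]] by (auto simp: density_between_def t_def)
    ultimately show "\<forall>n. continuous_on UNIV (t n) \<and> density_between a b (t n)" by blast
    have "AE x in lebesgue. x \<notin> N" using g(1) by (intro AE_not_in) (simp add: negligible_iff_null_sets)
    then have "AE x in lborel. x \<notin> N" by (simp add: AE_completion_iff)
    then show "AE x in lborel. (\<lambda>n. t n x) \<longlonglongrightarrow> s x"
    proof eventually_elim
      case (elim x)
      have "(\<lambda>n. t n x) \<longlonglongrightarrow> max a (min b (s x))" unfolding t_def by (intro tendsto_intros g elim)
      moreover have "max a (min b (s x)) = s x" using s by (simp add: density_between_def)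
      ultimately show ?case by simp
    qed
  qed
qed

text \<open>Otherwise, by closedness, a whole ball would be realizable. Adding to
  \<open>\<rho>0\<close> a shrunken copy of a continuous density and zooming in at 0 by the same
  factor makes \<open>\<rho>0\<close> look constant and leaves that density. So continuous
  densities, and by approximation the measurable \<open>s\<close>, would be realizable.\<close>

lemma realizable_nowhere_dense_Cplus:
  assumes \<rho>0: "\<rho>0 \<in> Cplus" and e: "0 < e"
  shows "\<exists>\<rho>\<in>Cplus. Cplus_dist \<rho>0 \<rho> < e \<and>
    (\<exists>d>0. \<forall>\<sigma>\<in>{\<sigma>. realizable K L \<sigma>} \<inter> Cplus. d \<le> Cplus_dist \<rho> \<sigma>)"
proof (rule ccontr)
  assume neg: "\<not> ?thesis"
  have cB: "\<exists>B. \<forall>x. norm x \<le> R \<longrightarrow> \<bar>\<rho> x\<bar> \<le> B" if "\<rho> \<in> Cplus" for \<rho> R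
  proof -
    have "compact (\<rho> ` cball 0 R)"
      using that by (intro compact_continuous_image) (auto simp: Cplus_def intro: continuous_on_subset)
    then have "bounded (\<rho> ` cball 0 R)" by (rule compact_imp_bounded)
    then obtain B where "\<forall>x\<in>cball 0 R. \<bar>\<rho> x\<bar> \<le> B" by (auto simp: bounded_iff)
    then show ?thesis by (intro exI[of _ B]) auto
  qed
  have cm: "\<rho> \<in> borel_measurable borel" if "\<rho> \<in> Cplus" for \<rho>
    using that by (auto simp: Cplus_def intro: borel_measurable_continuous_onI)
  have near: "realizable K L \<rho>" if \<rho>: "\<rho> \<in> Cplus" "Cplus_dist \<rho>0 \<rho> < e" for \<rho>
  proof (rule realizable_uniform_limit)
    show "\<rho> \<in> borel_measurable borel" by (rule cm) fact
    show "\<exists>B. AE x in lborel. norm x \<le> R \<longrightarrow> \<bar>\<rho> x\<bar> \<le> B" for R using cB[OF \<rho>(1), of R] by auto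
    fix d :: real assume d: "0 < d"
    have "\<not> (\<forall>\<sigma>\<in>{\<sigma>. realizable K L \<sigma>} \<inter> Cplus. min d 1 \<le> Cplus_dist \<rho> \<sigma>)"
      using neg \<rho> d by (metis less_numeral_extra(1) min_less_iff_conj)
    then obtain \<sigma> where \<sigma>: "realizable K L \<sigma>" "\<sigma> \<in> Cplus" "Cplus_dist \<rho> \<sigma> < min d 1"
      by (auto simp: not_le)
    have "\<bar>\<sigma> x - \<rho> x\<bar> \<le> d" for x
      using abs_diff_le_if_Cplus_dist_less[OF \<sigma>(3), of x] by (simp add: abs_minus_commute)
    then show "\<exists>t. t \<in> borel_measurable borel \<and> realizable K L t \<and> (AE x in lborel. \<bar>t x - \<rho> x\<bar> \<le> d)"
      using \<sigma> cm by (intro exI[of _ \<sigma>]) auto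
  qed
  \<comment> \<open>With these bounds \<open>t k - a\<close> takes values between 0 and
    \<open>e / 2\<close>, so adding it to \<open>\<rho>0\<close> preserves positivity and stays in
    the ball. Since \<open>a\<close> is the value at the centre of the zoom, the rescaled sums tend
    to \<open>t k\<close> itself.\<close>
  define a where "a = \<rho>0 0"
  define b where "b = a + e / 2"
  have ab: "0 < a" "a < b" using \<rho>0 e by (auto simp: a_def b_def Cplus_def)
  obtain s where s: "density_between a b s" "\<not> realizable K L s" using not_all_realizable[OF ab] by blast
  obtain t where t_all: "\<forall>n::nat. continuous_on UNIV (t n) \<and> density_between a b (t n)"
    and t_lim: "AE x in lborel. (\<lambda>n. t n x) \<longlonglongrightarrow> s x"
    using continuous_approximation[OF s(1) less_imp_le[OF ab(2)]] .
  have t: "continuous_on UNIV (t n)" "density_between a b (t n)" for n using t_all by simp_all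
  have bd: "\<bar>u x\<bar> \<le> b" if "density_between a b u" for u x
  proof -
    have "a \<le> u x" "u x \<le> b" using that by (auto simp: density_between_def)
    then show ?thesis using ab by linarith
  qed
  have mb: "u \<in> borel_measurable borel" if "density_between a b u" for u
    using that by (simp add: density_between_def)
  have "realizable K L (t k)" for k
  proof -
    define \<rho> where "\<rho> = (\<lambda>j x. \<rho>0 x + (t k (real (Suc j) *\<^sub>R x) - a))"
    have C: "\<rho> j \<in> Cplus" for j
    proof -
      have "continuous_on UNIV (\<lambda>x. t k (real (Suc j) *\<^sub>R x))"
        by (rule continuous_on_compose2[OF t(1)]) (auto intro!: continuous_intros)
      then have "continuous_on UNIV (\<rho> j)"
        unfolding \<rho>_def using \<rho>0 by (intro continuous_intros) (auto simp: Cplus_def)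
      moreover have "0 < \<rho> j x" for x
        using \<rho>0 t(2)[of k] by (auto simp: \<rho>_def Cplus_def density_between_def intro!: add_pos_nonneg)
      ultimately show ?thesis by (simp add: Cplus_def)
    qed
    have "Cplus_dist \<rho>0 (\<rho> j) \<le> e / 2" for j
    proof (rule Cplus_dist_le)
      fix x
      have "a \<le> t k (real (Suc j) *\<^sub>R x)" "t k (real (Suc j) *\<^sub>R x) \<le> a + e / 2"
        using t(2)[of k] by (simp_all only: density_between_def b_def)
      then show "\<bar>\<rho>0 x - \<rho> j x\<bar> \<le> e / 2" unfolding \<rho>_def by linarith
    qed
    then have "realizable K L (\<rho> j)" for j using near[OF C] e by (smt (verit) field_sum_of_halves)
    then have re: "realizable K L (\<lambda>x. \<rho> j (0 + inverse (real (Suc j)) *\<^sub>R x))" for j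
      by (intro realizable_rescale cm C) auto
    have eq: "\<rho> j (0 + inverse (real (Suc j)) *\<^sub>R x) = \<rho>0 (inverse (real (Suc j)) *\<^sub>R x) + (t k x - a)" for j x
      by (simp add: \<rho>_def)
    show ?thesis
    proof (rule realizable_limit[OF re[unfolded eq]])
      have m0: "\<rho>0 \<in> borel_measurable borel" using cm[OF \<rho>0] .
      note [measurable] = m0 mb[OF t(2)]
      show m: "(\<lambda>x. \<rho>0 (inverse (real (Suc j)) *\<^sub>R x) + (t k x - a)) \<in> borel_measurable borel" for j by measurable
      fix \<phi> :: "real^2 \<Rightarrow> real" assume \<phi>: "test_fun \<phi>"
      show "(\<lambda>j. \<integral>x. \<phi> x * (\<rho>0 (inverse (real (Suc j)) *\<^sub>R x) + (t k x - a)) \<partial>lborel) \<longlonglongrightarrow> (\<integral>x. \<phi> x * t k x \<partial>lborel)"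
      proof (rule tendsto_test_integral_AE[OF \<phi> m mb[OF t(2)]])
        show "\<exists>B. \<forall>j. AE x in lborel. norm x \<le> R \<longrightarrow> \<bar>\<rho>0 (inverse (real (Suc j)) *\<^sub>R x) + (t k x - a)\<bar> \<le> B" for R
        proof -
          obtain B where B: "\<And>x. norm x \<le> R \<Longrightarrow> \<bar>\<rho>0 x\<bar> \<le> B" using cB[OF \<rho>0] by blast
          have "\<bar>\<rho>0 (inverse (real (Suc j)) *\<^sub>R x) + (t k x - a)\<bar> \<le> B + (b + a)" if x: "norm x \<le> R" for j x
          proof -
            have "inverse (real (Suc j)) * norm x \<le> 1 * norm x" by (intro mult_right_mono) (auto simp: inverse_le_1_iff)
            then have "\<bar>\<rho>0 (inverse (real (Suc j)) *\<^sub>R x)\<bar> \<le> B" using x by (intro B) simp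
            then show ?thesis using bd[OF t(2), of k x] ab by linarith
          qed
          then show ?thesis by auto
        qed
        show "AE x in lborel. (\<lambda>j. \<rho>0 (inverse (real (Suc j)) *\<^sub>R x) + (t k x - a)) \<longlonglongrightarrow> t k x"
        proof (rule AE_I2)
          fix x :: "real^2"
          have "(\<lambda>j. inverse (real (Suc j)) *\<^sub>R x) \<longlonglongrightarrow> 0 *\<^sub>R x"
            by (rule tendsto_scaleR[OF LIMSEQ_inverse_real_of_nat tendsto_const])
          then have "(\<lambda>j. \<rho>0 (inverse (real (Suc j)) *\<^sub>R x)) \<longlonglongrightarrow> \<rho>0 0"
            using \<rho>0 by (intro continuous_on_tendsto_compose[of UNIV \<rho>0]) (auto simp: Cplus_def)
          then have "(\<lambda>j. \<rho>0 (inverse (real (Suc j)) *\<^sub>R x) + (t k x - a)) \<longlonglongrightarrow> \<rho>0 0 + (t k x - a)"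
            by (intro tendsto_intros)
          then show "(\<lambda>j. \<rho>0 (inverse (real (Suc j)) *\<^sub>R x) + (t k x - a)) \<longlonglongrightarrow> t k x" by (simp add: a_def)
        qed
      qed
    qed
  qed
  \<comment> \<open>The continuous \<open>t k\<close> converge to \<open>s\<close> almost
    everywhere, and realizability passes to the limit.\<close>
  then have "realizable K L s"
    by (rule realizable_limit[OF _ mb[OF t(2)]])
       (rule tendsto_test_integral_AE[OF _ mb[OF t(2)] mb[OF s(1)] _ t_lim], use bd[OF t(2)] in auto)
  with s(2) show False ..
qed

subsection \<open>Essentially bounded densities\<close>

lemma Linf_plus_classI:
  assumes "\<rho> \<in> Linf_funs" "AE x in lebesgue. 0 < \<rho> x"
  shows "Linf_rel `` {\<rho>} \<in> Linf_plus" "\<rho> \<in> Linf_rel `` {\<rho>}"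
proof -
  show "\<rho> \<in> Linf_rel `` {\<rho>}" using assms by (simp add: Linf_rel_def)
  have "AE x in lebesgue. 0 < \<sigma> x" if "\<sigma> \<in> Linf_rel `` {\<rho>}" for \<sigma>
  proof -
    have "AE x in lebesgue. \<rho> x = \<sigma> x" using that by (simp add: Linf_rel_def)
    with assms(2) show ?thesis by eventually_elim simp
  qed
  then show "Linf_rel `` {\<rho>} \<in> Linf_plus" using assms by (auto simp: Linf_plus_def intro: quotientI)
qed

text \<open>Members of a class are Lebesgue measurable, whereas rescaling and limits of realizable
  densities are set up for Borel functions.\<close>

lemma Linf_plus_borel_representative:
  assumes "R \<in> Linf_plus"
  obtains \<rho> where "\<rho> \<in> R" "\<rho> \<in> borel_measurable borel"
proof -
  have R: "R \<in> Linf_funs // Linf_rel" using assms by (simp add: Linf_plus_def)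
  define \<sigma> where "\<sigma> = (SOME \<sigma>. \<sigma> \<in> R)"
  have \<sigma>: "\<sigma> \<in> R" unfolding \<sigma>_def by (rule Linf_class_nonempty[OF R])
  have \<sigma>L: "\<sigma> \<in> Linf_funs" by (rule Linf_class_subset[OF R \<sigma>])
  then have "\<sigma> \<in> borel_measurable lebesgue" by (simp add: Linf_funs_def)
  then obtain \<rho> where \<rho>: "\<rho> \<in> borel_measurable lborel" "AE x in lborel. \<sigma> x = \<rho> x"
    using completion_ex_borel_measurable_real by blast
  have ae: "AE x in lebesgue. \<sigma> x = \<rho> x" using \<rho>(2) by (rule AE_completion)
  have "AE x in lebesgue. \<bar>\<rho> x\<bar> \<le> Linf_norm \<sigma>"
    using ae Linf_norm_AE_le[OF \<sigma>L] by eventually_elim simp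
  then have "\<rho> \<in> Linf_funs" using \<rho>(1) by (intro Linf_bounded measurable_completion)
  then have "(\<sigma>, \<rho>) \<in> Linf_rel" using ae \<sigma>L by (simp add: Linf_rel_def)
  then have "\<rho> \<in> R" using in_quotient_imp_closed[OF equiv_Linf_rel R \<sigma>] by blast
  then show ?thesis using that \<rho>(1) by simp
qed

text \<open>Point values of \<open>\<rho>0\<close> carry no information here, so they are replaced
  by a value \<open>a\<close> that \<open>\<rho>0\<close> nearly takes on a set of positive measure.
  Shrunken copies of \<open>s\<close> are written onto that set, and zooming in where it is almost
  full recovers \<open>s\<close> in the limit.\<close>

lemma realizable_nowhere_dense_Linf:
  assumes R0: "R0 \<in> Linf_plus" and e: "0 < e"
  shows "\<exists>R\<in>Linf_plus. Linf_dist R0 R < e \<and>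
    (\<exists>d>0. \<forall>S\<in>{S. \<exists>\<sigma>\<in>S. \<sigma> \<in> borel_measurable borel \<and> realizable K L \<sigma>} \<inter> Linf_plus. d \<le> Linf_dist R S)"
proof (rule ccontr)
  assume neg: "\<not> ?thesis"
  have Q: "R \<in> Linf_funs // Linf_rel" if "R \<in> Linf_plus" for R using that by (simp add: Linf_plus_def)
  obtain \<rho>0 where \<rho>0: "\<rho>0 \<in> R0" "\<rho>0 \<in> borel_measurable borel"
    using Linf_plus_borel_representative[OF R0] .
  have \<rho>0L: "\<rho>0 \<in> Linf_funs" by (rule Linf_class_subset[OF Q[OF R0] \<rho>0(1)])
  have "AE x in lebesgue. 0 < \<rho>0 x" using R0 \<rho>0(1) by (simp add: Linf_plus_def)
  then have pos: "AE x in lborel. 0 < \<rho>0 x" by (simp add: AE_completion_iff)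
  define C where "C = Linf_norm \<rho>0"
  have C: "AE x in lborel. \<bar>\<rho>0 x\<bar> \<le> C"
    using Linf_norm_AE_le[OF \<rho>0L] by (simp add: C_def AE_completion_iff)
  have near: "realizable K L \<rho>"
    if \<rho>: "\<rho> \<in> borel_measurable borel" "AE x in lborel. 0 < \<rho> x" "AE x in lborel. \<bar>\<rho>0 x - \<rho> x\<bar> \<le> e / 2" for \<rho>
  proof (rule realizable_uniform_limit[OF \<rho>(1)])
    have bd: "AE x in lborel. \<bar>\<rho> x\<bar> \<le> C + e / 2"
      using C \<rho>(3) by eventually_elim linarith
    then show "\<exists>B. AE x in lborel. norm x \<le> R \<longrightarrow> \<bar>\<rho> x\<bar> \<le> B" for R
      by (intro exI[of _ "C + e / 2"]) (auto elim: eventually_mono)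
    have \<rho>M: "\<rho> \<in> borel_measurable lebesgue" using \<rho>(1) by (intro measurable_completion) simp
    have \<rho>L: "\<rho> \<in> Linf_funs" using \<rho>M AE_completion[OF bd] by (rule Linf_bounded)
    let ?R = "Linf_rel `` {\<rho>}"
    note cl = Linf_plus_classI[OF \<rho>L AE_completion[OF \<rho>(2)]]
    have "Linf_dist R0 ?R = Linf_norm (\<lambda>x. \<rho>0 x - \<rho> x)"
      by (rule Linf_dist_eq[OF Q[OF R0] Q[OF cl(1)] \<rho>0(1) cl(2)])
    also have "\<dots> \<le> e / 2"
      using Linf_funs_diff[OF \<rho>0L \<rho>L] AE_completion[OF \<rho>(3)] by (intro Linf_bounded) (auto simp: Linf_funs_def)
    finally have dist: "Linf_dist R0 ?R < e" using e by simp
    fix d :: real assume d: "0 < d"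
    have "\<not> (\<forall>S\<in>{S. \<exists>\<sigma>\<in>S. \<sigma> \<in> borel_measurable borel \<and> realizable K L \<sigma>} \<inter> Linf_plus. d \<le> Linf_dist ?R S)"
      using neg cl(1) dist d by blast
    then obtain S \<sigma> where \<sigma>: "S \<in> Linf_plus" "\<sigma> \<in> S" "\<sigma> \<in> borel_measurable borel" "realizable K L \<sigma>" "Linf_dist ?R S < d"
      by (auto simp: not_le)
    have \<sigma>L: "\<sigma> \<in> Linf_funs" by (rule Linf_class_subset[OF Q[OF \<sigma>(1)] \<sigma>(2)])
    have "Linf_norm (\<lambda>x. \<rho> x - \<sigma> x) < d"
      using \<sigma>(5) by (simp add: Linf_dist_eq[OF Q[OF cl(1)] Q[OF \<sigma>(1)] cl(2) \<sigma>(2)])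
    moreover have "AE x in lborel. \<bar>\<rho> x - \<sigma> x\<bar> \<le> Linf_norm (\<lambda>x. \<rho> x - \<sigma> x)"
      using Linf_norm_AE_le[OF Linf_funs_diff[OF \<rho>L \<sigma>L]] by (simp add: AE_completion_iff)
    ultimately have "AE x in lborel. \<bar>\<sigma> x - \<rho> x\<bar> \<le> d" by (auto elim!: eventually_mono)
    then show "\<exists>t. t \<in> borel_measurable borel \<and> realizable K L t \<and> (AE x in lborel. \<bar>t x - \<rho> x\<bar> \<le> d)"
      using \<sigma> by blast
  qed
  \<comment> \<open>As \<open>\<rho>0\<close> is positive almost everywhere, the sets
    \<open>E q\<close> with rational \<open>q > 0\<close> cover almost the whole plane, so one of
    these countably many sets has positive measure.\<close>
  define E where "E = (\<lambda>q::rat. {x. \<bar>\<rho>0 x - real_of_rat q\<bar> < e / 4})"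
  note [measurable] = \<rho>0(2)
  have [measurable]: "E q \<in> sets borel" for q by (simp add: E_def)
  have "\<exists>q>0. emeasure lborel (E q) \<noteq> 0"
  proof (rule ccontr)
    assume "\<not> ?thesis"
    then have "AE x in lborel. x \<notin> (\<Union>q\<in>{q. 0 < q}. E q)"
      by (intro AE_not_in null_sets_UN') (auto simp: null_sets_def)
    then have "AE x in (lborel :: (real^2) measure). False"
      using pos
    proof eventually_elim
      case (elim x)
      obtain q where q: "max 0 (\<rho>0 x - e / 4) < real_of_rat q" "real_of_rat q < \<rho>0 x"
        using of_rat_dense[of "max 0 (\<rho>0 x - e / 4)" "\<rho>0 x"] elim e by auto
      then have "0 < q" "x \<in> E q" by (auto simp: E_def)
      with elim show False by blast
    qed
    then show False by (simp add: eventually_False ae_filter_eq_bot_iff)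
  qed
  then obtain q where q: "0 < q" "emeasure lborel (E q) \<noteq> 0" by blast
  define a where "a = real_of_rat q"
  \<comment> \<open>On \<open>E q\<close> both \<open>\<rho>0\<close> and the values of
    \<open>s\<close> lie within \<open>e / 4\<close> of \<open>a\<close>, so they differ by at most
    \<open>e / 2\<close>.\<close>
  define b where "b = a + e / 4"
  have ab: "0 < a" "a < b" using q e by (auto simp: a_def b_def)
  obtain s where s: "density_between a b s" "\<not> realizable K L s" using not_all_realizable[OF ab] by blast
  have sb: "a \<le> s x" "s x \<le> b" for x using s by (auto simp: density_between_def)
  have [measurable]: "s \<in> borel_measurable borel" using s by (simp add: density_between_def)
  have mc_ex: "\<exists>p. 0 < snd p \<and> emeasure lborel {x \<in> cball 0 (real (Suc k)). fst p + snd p *\<^sub>R x \<notin> E q}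
      \<le> ennreal (1 / real (Suc k))" for k
    by (rule blow_up_to_full_density[of "E q" "real (Suc k)" "1 / real (Suc k)"]) (use q(2) in auto)
  have "\<forall>k. \<exists>p. 0 < snd p \<and> emeasure lborel {x \<in> cball 0 (real (Suc k)). fst p + snd p *\<^sub>R x \<notin> E q}
      \<le> ennreal (1 / real (Suc k))"
    by (rule allI) (rule mc_ex)
  from choice[OF this] obtain p where p: "\<forall>k. 0 < snd (p k) \<and>
      emeasure lborel {x \<in> cball 0 (real (Suc k)). fst (p k) + snd (p k) *\<^sub>R x \<notin> E q} \<le> ennreal (1 / real (Suc k))" ..
  define m c where "m = fst \<circ> p" and "c = snd \<circ> p"
  have mc: "\<And>k. 0 < c k"
    "\<And>k. emeasure lborel {x \<in> cball 0 (real (Suc k)). m k + c k *\<^sub>R x \<notin> E q} \<le> ennreal (1 / real (Suc k))"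
    unfolding m_def c_def o_apply by (rule conjunct1[OF spec[OF p]], rule conjunct2[OF spec[OF p]])
  \<comment> \<open>Off \<open>E q\<close> the original density is kept. After the blow-up this
    region meets the ball of radius \<open>real (Suc k)\<close> in measure at most
    \<open>1 / real (Suc k)\<close>, so it disappears in the limit.\<close>
  define \<rho> where "\<rho> = (\<lambda>k z. if z \<in> E q then s ((z - m k) /\<^sub>R c k) else \<rho>0 z)"
  have [measurable]: "\<rho> k \<in> borel_measurable borel" for k unfolding \<rho>_def by measurable
  have \<rho>C: "AE z in lborel. \<bar>\<rho> k z\<bar> \<le> max b C" for k
    using C
  proof eventually_elim
    case (elim z)
    then show ?case using sb[of "(z - m k) /\<^sub>R c k"] ab by (auto simp: \<rho>_def)
  qed
  have "realizable K L (\<rho> k)" for k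
  proof (rule near)
    show "AE x in lborel. 0 < \<rho> k x"
      using pos
    proof eventually_elim
      case (elim x)
      then show ?case using sb(1)[of "(x - m k) /\<^sub>R c k"] ab(1) by (simp add: \<rho>_def)
    qed
    show "AE x in lborel. \<bar>\<rho>0 x - \<rho> k x\<bar> \<le> e / 2"
    proof (rule AE_I2)
      fix x
      show "\<bar>\<rho>0 x - \<rho> k x\<bar> \<le> e / 2"
      proof (cases "x \<in> E q")
        case True
        then have "\<bar>\<rho>0 x - a\<bar> < e / 4" "\<rho> k x = s ((x - m k) /\<^sub>R c k)"
          by (simp_all add: E_def a_def \<rho>_def)
        then show ?thesis using sb[of "(x - m k) /\<^sub>R c k"] e unfolding b_def by linarith
      qed (use e in \<open>simp add: \<rho>_def\<close>)
    qed
    show "\<rho> k \<in> borel_measurable borel" by measurable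
  qed
  then have re: "realizable K L (\<lambda>x. \<rho> k (m k + c k *\<^sub>R x))" for k
    by (rule realizable_rescale[OF _ mc(1)]) measurable
  have "realizable K L s"
  proof (rule realizable_limit[OF re])
    fix \<phi> :: "real^2 \<Rightarrow> real" assume \<phi>: "test_fun \<phi>"
    have "(\<lambda>k. (\<integral>x. \<phi> x * \<rho> k (m k + c k *\<^sub>R x) \<partial>lborel) - (\<integral>x. \<phi> x * s x \<partial>lborel)) \<longlonglongrightarrow> 0"
    proof (rule test_integral_diff_tendsto_0[OF \<phi>, where B = "max b C" and r = "\<lambda>k. real (Suc k)" and e = "\<lambda>k. 1 / real (Suc k)"])
      show "AE x in lborel. \<bar>\<rho> k (m k + c k *\<^sub>R x)\<bar> \<le> max b C" for k
        by (rule AE_lborel_affine[OF \<rho>C mc(1)])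
      show "AE x in lborel. \<bar>s x\<bar> \<le> max b C"
      proof (rule AE_I2)
        show "\<bar>s x\<bar> \<le> max b C" for x using sb[of x] ab by auto
      qed
      show "emeasure lborel {x \<in> cball 0 (real (Suc k)). \<rho> k (m k + c k *\<^sub>R x) \<noteq> s x} \<le> ennreal (1 / real (Suc k))" for k
      proof (rule order_trans[OF emeasure_mono mc(2)])
        show "{x \<in> cball 0 (real (Suc k)). \<rho> k (m k + c k *\<^sub>R x) \<noteq> s x}
            \<subseteq> {x \<in> cball 0 (real (Suc k)). m k + c k *\<^sub>R x \<notin> E q}"
          using mc(1)[of k] by (auto simp: \<rho>_def)
      qed measurable
      show "filterlim (\<lambda>k. real (Suc k)) at_top sequentially" by real_asymp
      show "(\<lambda>k. 1 / real (Suc k)) \<longlonglongrightarrow> 0" by real_asymp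
    qed (use ab in auto)
    then show "(\<lambda>k. \<integral>x. \<phi> x * \<rho> k (m k + c k *\<^sub>R x) \<partial>lborel) \<longlonglongrightarrow> (\<integral>x. \<phi> x * s x \<partial>lborel)"
      by (simp add: LIM_zero_iff)
  qed measurable
  with s(2) show False ..
qed

section \<open>Genericity in both function spaces\<close>

theorem mainTheorem1:
  shows "thick Cplus_metric
           {\<rho> \<in> Cplus. \<not> (\<exists>f :: real^2 \<Rightarrow> real^2. bi_lipschitz_homeo f \<and> Jac_eq_AE f \<rho>)}
       \<and> thick Linf_plus_metric
           {R \<in> Linf_plus. \<not> (\<exists>f :: real^2 \<Rightarrow> real^2. bi_lipschitz_homeo f \<and> (\<exists>\<rho>\<in>R. Jac_eq_AE f \<rho>))}"
proof
  show "thick Cplus_metric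
      {\<rho> \<in> Cplus. \<not> (\<exists>f :: real^2 \<Rightarrow> real^2. bi_lipschitz_homeo f \<and> Jac_eq_AE f \<rho>)}"
  \<comment> \<open>Every bi-Lipschitz homeomorphism and its inverse share a natural number as
    Lipschitz constant, so countably many nowhere dense sets cover the exceptional
    densities.\<close>
  proof (rule thick_if_complement_meager[where A = "\<lambda>n. {\<rho>. realizable (real n) (real n) \<rho>}"])
    show "mspace Cplus_metric - {\<rho> \<in> Cplus. \<not> (\<exists>f :: real^2 \<Rightarrow> real^2. bi_lipschitz_homeo f \<and> Jac_eq_AE f \<rho>)}
        \<subseteq> (\<Union>n. {\<rho>. realizable (real n) (real n) \<rho>})"
    proof
      fix \<rho> assume "\<rho> \<in> mspace Cplus_metric - {\<rho> \<in> Cplus. \<not> (\<exists>f :: real^2 \<Rightarrow> real^2. bi_lipschitz_homeo f \<and> Jac_eq_AE f \<rho>)}"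
      then obtain f where f: "bi_lipschitz_homeo f" "Jac_eq_AE f \<rho>" and \<rho>: "\<rho> \<in> Cplus" by auto
      have "\<exists>n::nat. realizable (real n) (real n) \<rho>"
        by (rule realizable_if_Jac_eq_AE[OF f])
           (use \<rho> in \<open>auto simp: Cplus_def intro: borel_measurable_continuous_onI\<close>)
      then show "\<rho> \<in> (\<Union>n. {\<rho>. realizable (real n) (real n) \<rho>})" by auto
    qed
  qed (use realizable_nowhere_dense_Cplus in auto)
  show "thick Linf_plus_metric
      {R \<in> Linf_plus. \<not> (\<exists>f :: real^2 \<Rightarrow> real^2. bi_lipschitz_homeo f \<and> (\<exists>\<rho>\<in>R. Jac_eq_AE f \<rho>))}"
  \<comment> \<open>A class belongs to the \<open>n\<close>-th set if one of its Borel members is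
    realizable. The Jacobian equation for any member passes to a Borel one, since members of a class
    agree almost everywhere.\<close>
  proof (rule thick_if_complement_meager[where
        A = "\<lambda>n. {S. \<exists>\<sigma>\<in>S. \<sigma> \<in> borel_measurable borel \<and> realizable (real n) (real n) \<sigma>}"])
    show "mspace Linf_plus_metric -
         {R \<in> Linf_plus. \<not> (\<exists>f :: real^2 \<Rightarrow> real^2. bi_lipschitz_homeo f \<and> (\<exists>\<rho>\<in>R. Jac_eq_AE f \<rho>))}
       \<subseteq> (\<Union>n. {S. \<exists>\<sigma>\<in>S. \<sigma> \<in> borel_measurable borel \<and> realizable (real n) (real n) \<sigma>})"
    proof
      fix R assume "R \<in> mspace Linf_plus_metric -
         {R \<in> Linf_plus. \<not> (\<exists>f :: real^2 \<Rightarrow> real^2. bi_lipschitz_homeo f \<and> (\<exists>\<rho>\<in>R. Jac_eq_AE f \<rho>))}"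
      then obtain f \<rho> where f: "bi_lipschitz_homeo f" "Jac_eq_AE f \<rho>" and R: "R \<in> Linf_plus" "\<rho> \<in> R" by auto
      obtain \<sigma> where \<sigma>: "\<sigma> \<in> R" "\<sigma> \<in> borel_measurable borel" using Linf_plus_borel_representative[OF R(1)] .
      have "AE x in lebesgue. \<rho> x = \<sigma> x" "AE x in lebesgue. 0 < \<rho> x"
        using R \<sigma>(1) Linf_class_AE_eq[of R \<rho> \<sigma>] by (auto simp: Linf_plus_def)
      then have "\<exists>n::nat. realizable (real n) (real n) \<sigma>"
        by (intro realizable_if_Jac_eq_AE[OF f] \<sigma>(2))
      then show "R \<in> (\<Union>n. {S. \<exists>\<sigma>\<in>S. \<sigma> \<in> borel_measurable borel \<and> realizable (real n) (real n) \<sigma>})"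
        using \<sigma> by auto
    qed
    show "\<exists>R\<in>mspace Linf_plus_metric. mdist Linf_plus_metric x R < e \<and>
        (\<exists>d>0. \<forall>z\<in>{S. \<exists>\<sigma>\<in>S. \<sigma> \<in> borel_measurable borel \<and> realizable (real n) (real n) \<sigma>} \<inter> mspace Linf_plus_metric.
          d \<le> mdist Linf_plus_metric R z)" if "x \<in> mspace Linf_plus_metric" "0 < e" for n x e
      using realizable_nowhere_dense_Linf that by simp
  qed auto
qed

end
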